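(* Let $a^*,b^*,q$ satisfy the assumptions (L) stated in the context, and let condition (B3) stated in the context be fulfilled. Then, for any $g\in BC(\Pi;\mathbb R^n)$, the linear space-periodic problem (LP$_{\rm per}$) described in the context has a unique bounded continuous solution $v$. Moreover, the estimate $$\|v\|_{BC}\le K\|g\|_{BC}$$ is fulfilled with a positive constant $K$ not depending on $g$.
   Context: **Function spaces.** $\Pi=\{(x,t)\in\mathbb R^2:0\le x\le1\}$. $BC(\Pi;\mathbb R^n)$ is the Banach space of bounded continuous maps $u:\Pi\to\mathbb R^n$ with $\|u\|_{BC}=\sup\{|u_j(x,t)|:(x,t)\in\Pi,\ j\le n\}$; $BC^1(\Pi;\mathbb R^n)$ is the space of continuously differentiable maps that are bounded together with their first-order derivatives. For $n=1$ write $BC(\Pi)$, $BC^1(\Pi)$. **Assumptions (L).** $a^*=(a^*_{jk})$, $b^*=(b^*_{jk})$ are $n\times n$ matrices of real-valued functions with $a^*_{jk}\in BC^1(\Pi)$, $b^*_{jk}\in BC(\Pi)$. The matrix $a^*(x,t)$ has $n$ real eigenvalues $a_1(x,t)>\dots>a_m(x,t)>0>a_{m+1}(x,t)>\dots>a_n(x,t)$ for some integer $0\le m\le n$. $q=(q_{jk})$ is a nondegenerate $n\times n$ matrix with $q_{jk}\in BC^1(\Pi)$ and $a:=q^{-1}a^*q=\operatorname{diag}(a_1,\dots,a_n)$. There is $\lambda_0>0$ such that $\inf_\Pi a_j>\lambda_0$ for $1\le j\le m$, $\sup_\Pi a_j<-\lambda_0$ for $m<j\le n$, $\inf_\Pi|a_j-a_k|>\lambda_0$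 for $1\le j\ne k\le n$, and $\inf_\Pi|\det q|>\lambda_0$. **Problem (LP$_{\rm per}$).** The unknown is $v$: $$\partial_tv+a^*(x,t)\partial_xv+b^*(x,t)v=g(x,t),\qquad x\in(0,1),\ t\in\mathbb R,$$ $$u_j(0,t)=u_j(1,t),\quad j\le n,\ t\in\mathbb R,\qquad u=q^{-1}v.$$ **Notation.** $b=q^{-1}(b^*q+\partial_tq+a^*\partial_xq)$. For $(x,t)\in\Pi$, $\xi\in[0,1]\mapsto\omega_j(\xi)=\omega_j(\xi,x,t)$ solves $\partial_\xi\omega_j(\xi,x,t)=1/a_j(\xi,\omega_j(\xi,x,t))$, $\omega_j(x,x,t)=t$. Put $x_j=0$ for $1\le j\le m$, $x_j=1$ for $m<j\le n$, and $$c_j(\xi,x,t)=\exp\int_x^\xi\Bigl[\frac{b_{jj}}{a_j}\Bigr](\eta,\omega_j(\eta,x,t))\,d\eta,\qquad d_j(\xi,x,t)=\frac{c_j(\xi,x,t)}{a_j(\xi,\omega_j(\xi,x,t))}.$$ **Bounded continuous solution.** A function $v\in BC(\Pi;\mathbb R^n)$ is a bounded continuous solution to (LP$_{\rm per}$) if $u=q^{-1}v$ satisfies, for all $j\le n$ and all $(x,t)\in\Pi$, $$u_j(x,t)=c_j(x_j,x,t)\,u_j(1-x_j,\omega_j(x_j))-\int_{x_j}^xd_j(\xi,x,t)\Bigl(\sum_{k\ne j}b_{jk}(\xi,\omega_j(\xi))u_k(\xi,\omega_j(\xi))-(q^{-1}g)_j(\xi,\omega_j(\xi))\Bigr)d\xi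 .$$ **Condition (B3).** With $$\tilde\gamma_j=\inf_{(x,t)\in\Pi}\Bigl|\frac{b_{jj}}{a_j}\Bigr|,\qquad\beta_j=\sup_{(x,t)\in\Pi}\sum_{k\ne j}\Bigl|\frac{b_{jk}}{a_j}\Bigr|,$$ for each $j\le n$ it holds $\inf_{x,t}|b_{jj}|\ne0$ and $\frac{\beta_j}{\tilde\gamma_j}\bigl(2-e^{-\tilde\gamma_j}\bigr)<1$. *)

theory Defs
  imports "HOL-Analysis.Analysis"
begin

text \<open>
  The index set \<open>{1, ..., n}\<close> is rendered by a type \<open>'n :: {finite, linorder}\<close>, which is
  order isomorphic to \<open>{1, ..., CARD('n)}\<close>; the isomorphism sends \<open>j\<close> to \<open>card {..j}\<close>.
  Functions on the strip are total functions on the plane, and only their values on the strip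
  are ever constrained.
\<close>

type_synonym 'n vec_fun = "real \<times> real \<Rightarrow> real ^ 'n"
type_synonym 'n mat_fun = "real \<times> real \<Rightarrow> real ^ 'n ^ 'n"

definition strip :: "(real \<times> real) set" where
  "strip = {0..1} \<times> UNIV"

definition BC :: "(real \<times> real \<Rightarrow> 'b::real_normed_vector) set" where
  "BC = {f. continuous_on strip f \<and> bounded (f ` strip)}"

definition bc_norm :: "('n::finite) vec_fun \<Rightarrow> real" where
  "bc_norm u = (SUP (p, j) \<in> strip \<times> UNIV. \<bar>u p $ j\<bar>)"

text \<open>The \<open>x\<close>-derivative is one-sided on the boundary lines \<open>x = 0\<close> and \<open>x = 1\<close>.\<close>

definition dx :: "(real \<times> real \<Rightarrow> real) \<Rightarrow> real \<times> real \<Rightarrow> real" where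
  "dx f = (\<lambda>(x, t). vector_derivative (\<lambda>\<xi>. f (\<xi>, t)) (at x within {0..1}))"

definition dt :: "(real \<times> real \<Rightarrow> real) \<Rightarrow> real \<times> real \<Rightarrow> real" where
  "dt f = (\<lambda>(x, t). vector_derivative (\<lambda>\<tau>. f (x, \<tau>)) (at t))"

definition BC1 :: "(real \<times> real \<Rightarrow> real) set" where
  "BC1 = {f. f \<in> BC
     \<and> (\<forall>(x, t) \<in> strip. (\<lambda>\<xi>. f (\<xi>, t)) differentiable (at x within {0..1})
                        \<and> (\<lambda>\<tau>. f (x, \<tau>)) differentiable (at t))
     \<and> dx f \<in> BC \<and> dt f \<in> BC}"

text \<open>\<open>upto_m m j\<close> says \<open>1 \<le> j \<le> m\<close>, i.e. \<open>j\<close> is one of the first \<open>m\<close> indices.\<close>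

definition upto_m :: "nat \<Rightarrow> 'n::{finite, linorder} \<Rightarrow> bool" where
  "upto_m m j \<longleftrightarrow> card {..j} \<le> m"

definition assumptions_L ::
  "('n::{finite, linorder}) mat_fun \<Rightarrow> 'n mat_fun \<Rightarrow> 'n mat_fun \<Rightarrow>
   ('n \<Rightarrow> real \<times> real \<Rightarrow> real) \<Rightarrow> nat \<Rightarrow> bool" where
  "assumptions_L astar bstar q a m \<longleftrightarrow>
     (\<forall>j k. (\<lambda>p. astar p $ j $ k) \<in> BC1 \<and> (\<lambda>p. bstar p $ j $ k) \<in> BC
          \<and> (\<lambda>p. q p $ j $ k) \<in> BC1)
   \<and> m \<le> CARD('n)
   \<and> (\<forall>p\<in>strip.
         (\<forall>j. \<exists>w. w \<noteq> 0 \<and> astar p *v w = a j p *s w)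
       \<and> (\<forall>j k. j < k \<longrightarrow> a k p < a j p)
       \<and> (\<forall>j. if upto_m m j then 0 < a j p else a j p < 0)
       \<and> invertible (q p)
       \<and> matrix_inv (q p) ** astar p ** q p = (\<chi> j k. if j = k then a j p else 0))
   \<and> (\<exists>lam0>0.
         (\<forall>j. upto_m m j \<longrightarrow> (INF p\<in>strip. a j p) > lam0)
       \<and> (\<forall>j. \<not> upto_m m j \<longrightarrow> (SUP p\<in>strip. a j p) < - lam0)
       \<and> (\<forall>j k. j \<noteq> k \<longrightarrow> (INF p\<in>strip. \<bar>a j p - a k p\<bar>) > lam0)
       \<and> (INF p\<in>strip. \<bar>det (q p)\<bar>) > lam0)"

definition b_mat ::
  "('n::{finite, linorder}) mat_fun \<Rightarrow> 'n mat_fun \<Rightarrow> 'n mat_fun \<Rightarrow> 'n mat_fun" where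
  "b_mat astar bstar q p =
     matrix_inv (q p) **
       (bstar p ** q p
        + (\<chi> j k. dt (\<lambda>p. q p $ j $ k) p)
        + astar p ** (\<chi> j k. dx (\<lambda>p. q p $ j $ k) p))"

text \<open>
  For \<open>a j\<close> as in \<open>assumptions_L\<close>, \<open>1 / a j\<close> is bounded and globally Lipschitz in its second
  argument, so that the values of the chosen function on \<open>{0..1}\<close>, the only ones used below,
  are uniquely determined.
\<close>

definition omega ::
  "('n::{finite, linorder} \<Rightarrow> real \<times> real \<Rightarrow> real) \<Rightarrow> 'n \<Rightarrow> real \<Rightarrow> real \<Rightarrow> real \<Rightarrow> real" where
  "omega a j \<xi> x t =
     (SOME w. w x = t \<and>
        (\<forall>\<eta>\<in>{0..1}. (w has_real_derivative 1 / a j (\<eta>, w \<eta>)) (at \<eta> within {0..1}))) \<xi>"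

definition x_start :: "nat \<Rightarrow> 'n::{finite, linorder} \<Rightarrow> real" where
  "x_start m j = (if upto_m m j then 0 else 1)"

definition c_coef ::
  "('n::{finite, linorder} \<Rightarrow> real \<times> real \<Rightarrow> real) \<Rightarrow> 'n mat_fun \<Rightarrow>
   'n \<Rightarrow> real \<Rightarrow> real \<Rightarrow> real \<Rightarrow> real" where
  "c_coef a b j \<xi> x t =
     exp (LBINT \<eta>=ereal x..ereal \<xi>.
            b (\<eta>, omega a j \<eta> x t) $ j $ j / a j (\<eta>, omega a j \<eta> x t))"

definition d_coef ::
  "('n::{finite, linorder} \<Rightarrow> real \<times> real \<Rightarrow> real) \<Rightarrow> 'n mat_fun \<Rightarrow>
   'n \<Rightarrow> real \<Rightarrow> real \<Rightarrow> real \<Rightarrow> real" where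
  "d_coef a b j \<xi> x t = c_coef a b j \<xi> x t / a j (\<xi>, omega a j \<xi> x t)"

text \<open>
  Integrating along characteristics turns the problem
  \<open>v_t + astar v_x + bstar v = g\<close>, \<open>u_j(0,t) = u_j(1,t)\<close>, \<open>u = q^{-1} v\<close>, into the system of
  integral equations below. The integrals are oriented, as \<open>x_start m j\<close> may exceed \<open>x\<close>.
\<close>

definition bc_solution ::
  "('n::{finite, linorder}) mat_fun \<Rightarrow> 'n mat_fun \<Rightarrow> 'n mat_fun \<Rightarrow>
   ('n \<Rightarrow> real \<times> real \<Rightarrow> real) \<Rightarrow> nat \<Rightarrow>
   'n vec_fun \<Rightarrow> 'n vec_fun \<Rightarrow> bool" where
  "bc_solution astar bstar q a m g v \<longleftrightarrow>
     v \<in> BC \<and>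
     (let b = b_mat astar bstar q;
          u = (\<lambda>p. matrix_inv (q p) *v v p);
          h = (\<lambda>p. matrix_inv (q p) *v g p)
      in \<forall>j. \<forall>(x, t) \<in> strip.
           u (x, t) $ j =
             c_coef a b j (x_start m j) x t
               * u (1 - x_start m j, omega a j (x_start m j) x t) $ j
             - (LBINT \<xi>=ereal (x_start m j)..ereal x.
                  d_coef a b j \<xi> x t *
                    ((\<Sum>k | k \<noteq> j. b (\<xi>, omega a j \<xi> x t) $ j $ k
                                    * u (\<xi>, omega a j \<xi> x t) $ k)
                     - h (\<xi>, omega a j \<xi> x t) $ j)))"

definition gamma_tilde ::
  "('n::{finite, linorder} \<Rightarrow> real \<times> real \<Rightarrow> real) \<Rightarrow> 'n mat_fun \<Rightarrow> 'n \<Rightarrow> real" where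
  "gamma_tilde a b j = (INF p\<in>strip. \<bar>b p $ j $ j / a j p\<bar>)"

definition beta ::
  "('n::{finite, linorder} \<Rightarrow> real \<times> real \<Rightarrow> real) \<Rightarrow> 'n mat_fun \<Rightarrow> 'n \<Rightarrow> real" where
  "beta a b j = (SUP p\<in>strip. \<Sum>k | k \<noteq> j. \<bar>b p $ j $ k / a j p\<bar>)"

definition condition_B3 ::
  "('n::{finite, linorder} \<Rightarrow> real \<times> real \<Rightarrow> real) \<Rightarrow> 'n mat_fun \<Rightarrow> bool" where
  "condition_B3 a b \<longleftrightarrow>
     (\<forall>j. (INF p\<in>strip. \<bar>b p $ j $ j\<bar>) \<noteq> 0
        \<and> beta a b j / gamma_tilde a b j * (2 - exp (- gamma_tilde a b j)) < 1)"

end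

theory Submission imports Defs begin

text \<open>
  Let \<open>c\<close> be the factor \<open>c\<^sub>j(y, x, t)\<close> for a starting line \<open>x = y\<close>. Its derivative along the
  characteristic is \<open>c b\<^sub>j\<^sub>j / a\<^sub>j\<close>, so the integral term in the \<open>j\<close>-th equation is at most
  \<open>(1 - c) sup |F / b\<^sub>j\<^sub>j|\<close>, where \<open>F\<close> is the source, provided that \<open>c \<le> 1\<close>. Now \<open>b\<^sub>j\<^sub>j / a\<^sub>j\<close> has constant
  sign because the strip is connected. If this sign makes \<open>c\<close> grow instead of decay for \<open>y = x\<^sub>j\<close>,
  one passes to the starting line \<open>y = 1 - x\<^sub>j\<close>: periodicity makes the two systems equivalent.
  Each component is then a convex combination with weights \<open>c\<close> and \<open>1 - c\<close> of a boundary value and of a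
  quantity bounded by \<open>(\<beta>\<^sub>j / \<gamma>\<^sub>j) sup |u|\<close>, up to a term in \<open>g\<close>. Since \<open>c \<le> exp (- \<gamma>\<^sub>j)\<close> on the line
  \<open>x = 1 - y\<close> that supplies the boundary values, the square of the integral operator is a contraction.
  Here \<open>\<beta>\<^sub>j / \<gamma>\<^sub>j < 1\<close> follows from (B3) and \<open>2 - exp (- \<gamma>\<^sub>j) \<ge> 1\<close>.
\<close>

section \<open>Bounded functions on the strip\<close>

lemma mem_strip: "(x, t) \<in> strip \<longleftrightarrow> x \<in> {0..1}"
  by (simp add: strip_def)

lemma BC_iff: "f \<in> BC \<longleftrightarrow> continuous_on strip f \<and> (\<exists>M. \<forall>p\<in>strip. norm (f p) \<le> M)"
  unfolding BC_def bounded_iff by auto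

lemma BC_bound_pos:
  assumes "f \<in> BC"
  obtains M where "M > 0" "\<And>p. p \<in> strip \<Longrightarrow> norm (f p) \<le> M"
proof -
  obtain M where M: "\<And>p. p \<in> strip \<Longrightarrow> norm (f p) \<le> M"
    using assms unfolding BC_iff by auto
  show ?thesis
  proof (rule that[of "max M 1"])
    show "norm (f p) \<le> max M 1" if "p \<in> strip" for p
      using M[OF that] by simp
  qed simp
qed

lemma BC_uniform_bound_pos:
  fixes f :: "'i::finite \<Rightarrow> _"
  assumes "\<And>i. f i \<in> BC"
  obtains M where "M > 0" "\<And>i p. p \<in> strip \<Longrightarrow> norm (f i p) \<le> M"
proof -
  have "\<forall>i. \<exists>M. M > 0 \<and> (\<forall>p\<in>strip. norm (f i p) \<le> M)"
    using BC_bound_pos[OF assms] by metis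
  then obtain M where M: "\<And>i. M i > 0" "\<And>i p. p \<in> strip \<Longrightarrow> norm (f i p) \<le> M i"
    by metis
  show ?thesis
  proof (rule that[of "Max (range M)"])
    show "Max (range M) > 0"
      using M(1) by (subst Max_gr_iff) auto
    show "norm (f i p) \<le> Max (range M)" if "p \<in> strip" for i p
    proof -
      have "M i \<le> Max (range M)"
        by (rule Max_ge) auto
      then show ?thesis
        using M(2)[OF that, of i] by linarith
    qed
  qed
qed

section \<open>Closure of bounded continuous functions under algebraic operations\<close>

lemma BC_const: "(\<lambda>p. c) \<in> BC"
  unfolding BC_iff by auto

lemma BC_add: "f \<in> BC \<Longrightarrow> g \<in> BC \<Longrightarrow> (\<lambda>p. f p + g p) \<in> BC"
  unfolding BC_iff
  by (auto intro!: continuous_intros) (meson add_mono norm_triangle_ineq order_trans)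

lemma BC_mult:
  fixes f g :: "real \<times> real \<Rightarrow> real"
  assumes "f \<in> BC" "g \<in> BC"
  shows "(\<lambda>p. f p * g p) \<in> BC"
proof -
  obtain M where M: "M > 0" "\<And>p. p \<in> strip \<Longrightarrow> norm (f p) \<le> M" using BC_bound_pos[OF assms(1)] by blast
  obtain N where N: "N > 0" "\<And>p. p \<in> strip \<Longrightarrow> norm (g p) \<le> N" using BC_bound_pos[OF assms(2)] by blast
  have "norm (f p * g p) \<le> M * N" if "p \<in> strip" for p
    unfolding norm_mult using M(1) M(2)[OF that] N(2)[OF that] by (intro mult_mono) auto
  moreover have "continuous_on strip (\<lambda>p. f p * g p)"
    using assms unfolding BC_iff by (auto intro!: continuous_intros)
  ultimately show ?thesis unfolding BC_iff by blast
qed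

lemma BC_sum: "finite I \<Longrightarrow> (\<And>i. i \<in> I \<Longrightarrow> f i \<in> BC) \<Longrightarrow> (\<lambda>p. \<Sum>i\<in>I. f i p) \<in> BC"
  by (induction I rule: finite_induct) (auto intro!: BC_add BC_const)

lemma BC_inverse:
  fixes f :: "real \<times> real \<Rightarrow> real"
  assumes "f \<in> BC" "l > 0" "\<And>p. p \<in> strip \<Longrightarrow> l \<le> \<bar>f p\<bar>"
  shows "(\<lambda>p. 1 / f p) \<in> BC"
proof -
  have "norm (1 / f p) \<le> 1 / l" if "p \<in> strip" for p
    using assms(2) assms(3)[OF that] by (simp add: frac_le)
  moreover have "continuous_on strip (\<lambda>p. 1 / f p)"
    using assms unfolding BC_iff by (auto intro!: continuous_intros) force
  ultimately show ?thesis unfolding BC_iff by blast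
qed

lemma BC_vec_iff:
  fixes f :: "real \<times> real \<Rightarrow> real ^ 'n"
  shows "f \<in> BC \<longleftrightarrow> (\<forall>j. (\<lambda>p. f p $ j) \<in> BC)"
proof
  assume f: "f \<in> BC"
  then obtain M where M: "\<And>p. p \<in> strip \<Longrightarrow> norm (f p) \<le> M" unfolding BC_iff by auto
  have "norm (f p $ j) \<le> M" if "p \<in> strip" for p j
    using M[OF that] component_le_norm_cart[of "f p" j] by simp
  moreover have "continuous_on strip (\<lambda>p. f p $ j)" for j
    using f unfolding BC_iff by (intro continuous_intros) auto
  ultimately show "\<forall>j. (\<lambda>p. f p $ j) \<in> BC"
    unfolding BC_iff by blast
next
  assume f: "\<forall>j. (\<lambda>p. f p $ j) \<in> BC"
  then obtain M where M: "\<And>j p. p \<in> strip \<Longrightarrow> norm (f p $ j) \<le> M"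
    using BC_uniform_bound_pos[of "\<lambda>j p. f p $ j"] by blast
  have "norm (f p) \<le> (\<Sum>j\<in>(UNIV::'n set). M)" if "p \<in> strip" for p
    using norm_le_l1_cart[of "f p"] sum_mono[of UNIV "\<lambda>j. \<bar>f p $ j\<bar>" "\<lambda>_. M"] M[OF that] by auto
  moreover have "continuous_on strip (\<lambda>p. \<chi> j. f p $ j)"
    using f unfolding BC_iff by (intro continuous_on_vec_lambda) auto
  ultimately show "f \<in> BC"
    unfolding BC_iff vec_lambda_eta by blast
qed

lemma BC_component_bound:
  fixes f :: "real \<times> real \<Rightarrow> real ^ 'n"
  assumes "f \<in> BC"
  obtains M where "M > 0" "\<And>p j. p \<in> strip \<Longrightarrow> \<bar>f p $ j\<bar> \<le> M"
proof -
  have "(\<lambda>p. f p $ j) \<in> BC" for j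
    using assms unfolding BC_vec_iff by blast
  from BC_uniform_bound_pos[of "\<lambda>j p. f p $ j", OF this] that show ?thesis
    unfolding real_norm_def by metis
qed

lemma BC_matrix_bound:
  fixes A :: "real \<times> real \<Rightarrow> real ^ 'n ^ 'm"
  assumes "\<And>i k. (\<lambda>p. A p $ i $ k) \<in> BC"
  obtains M where "M > 0" "\<And>p i k. p \<in> strip \<Longrightarrow> \<bar>A p $ i $ k\<bar> \<le> M"
proof -
  obtain M where M: "M > 0" "\<And>ik p. p \<in> strip \<Longrightarrow> norm (A p $ fst ik $ snd ik) \<le> M"
    using BC_uniform_bound_pos[of "\<lambda>ik p. A p $ fst ik $ snd ik", OF assms] by metis
  show ?thesis
  proof (rule that[OF M(1)])
    show "\<bar>A p $ i $ k\<bar> \<le> M" if "p \<in> strip" for p i k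
      using M(2)[OF that, of "(i, k)"] by simp
  qed
qed

lemma BC_matrix_vector_mult:
  fixes A :: "real \<times> real \<Rightarrow> real ^ 'n ^ 'm"
  assumes "\<And>i j. (\<lambda>p. A p $ i $ j) \<in> BC" "u \<in> BC"
  shows "(\<lambda>p. A p *v u p) \<in> BC"
  unfolding BC_vec_iff matrix_vector_mult_def vec_lambda_beta
  using assms(1) assms(2)[unfolded BC_vec_iff]
  by (intro allI BC_sum BC_mult) auto

text \<open>The coefficients and the speeds are algebraic expressions in the data, so it suffices
  to work with a class of functions that is closed under the field operations.\<close>

definition BCL :: "(real \<times> real \<Rightarrow> real) set" where
  "BCL = {f \<in> BC. \<exists>L. \<forall>x\<in>{0..1}. \<forall>s t. \<bar>f (x, s) - f (x, t)\<bar> \<le> L * \<bar>s - t\<bar>}"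

lemma BCL_BC: "f \<in> BCL \<Longrightarrow> f \<in> BC"
  unfolding BCL_def by simp

lemma BCL_I:
  assumes "f \<in> BC" "\<And>x s t. 0 \<le> x \<Longrightarrow> x \<le> 1 \<Longrightarrow> \<bar>f (x, s) - f (x, t)\<bar> \<le> L * \<bar>s - t\<bar>"
  shows "f \<in> BCL"
  unfolding BCL_def using assms(1) by (auto intro!: exI[of _ L] assms(2))

lemma BCL_E:
  assumes "f \<in> BCL"
  obtains L where "L > 0" "\<And>x s t. 0 \<le> x \<Longrightarrow> x \<le> 1 \<Longrightarrow> \<bar>f (x, s) - f (x, t)\<bar> \<le> L * \<bar>s - t\<bar>"
proof -
  obtain L where L: "\<And>x s t. 0 \<le> x \<Longrightarrow> x \<le> 1 \<Longrightarrow> \<bar>f (x, s) - f (x, t)\<bar> \<le> L * \<bar>s - t\<bar>"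
    using assms unfolding BCL_def by fastforce
  show ?thesis
  proof (rule that[of "max L 1"])
    fix x s t :: real
    assume "0 \<le> x" "x \<le> 1"
    then have "\<bar>f (x, s) - f (x, t)\<bar> \<le> L * \<bar>s - t\<bar>"
      by (rule L)
    also have "\<dots> \<le> max L 1 * \<bar>s - t\<bar>"
      by (rule mult_right_mono) auto
    finally show "\<bar>f (x, s) - f (x, t)\<bar> \<le> max L 1 * \<bar>s - t\<bar>" .
  qed simp
qed

text \<open>Functions are total on the plane but constrained only on the strip. This lemma carries
  regularity over to inverse matrices and to the speeds, which agree with an explicit formula only
  there.\<close>

lemma BCL_cong:
  assumes "f \<in> BCL" "\<And>p. p \<in> strip \<Longrightarrow> g p = f p"
  shows "g \<in> BCL"
  using assms unfolding BCL_def BC_iff by (auto simp: mem_strip cong: continuous_on_cong)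

lemma BCL_const: "(\<lambda>p. c) \<in> BCL"
  by (rule BCL_I[of _ 0]) (auto intro: BC_const)

lemma BCL_add:
  assumes "f \<in> BCL" "g \<in> BCL"
  shows "(\<lambda>p. f p + g p) \<in> BCL"
proof -
  obtain L where L: "\<And>x s t. 0 \<le> x \<Longrightarrow> x \<le> 1 \<Longrightarrow> \<bar>f (x, s) - f (x, t)\<bar> \<le> L * \<bar>s - t\<bar>"
    using BCL_E[OF assms(1)] by metis
  obtain M where M: "\<And>x s t. 0 \<le> x \<Longrightarrow> x \<le> 1 \<Longrightarrow> \<bar>g (x, s) - g (x, t)\<bar> \<le> M * \<bar>s - t\<bar>"
    using BCL_E[OF assms(2)] by metis
  show ?thesis
  proof (rule BCL_I[of _ "L + M"])
    show "(\<lambda>p. f p + g p) \<in> BC"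
      using assms by (intro BC_add BCL_BC)
    fix x s t :: real assume x: "0 \<le> x" "x \<le> 1"
    show "\<bar>f (x, s) + g (x, s) - (f (x, t) + g (x, t))\<bar> \<le> (L + M) * \<bar>s - t\<bar>"
      using L[OF x, of s t] M[OF x, of s t] unfolding distrib_right by linarith
  qed
qed

lemma BCL_mult:
  assumes "f \<in> BCL" "g \<in> BCL"
  shows "(\<lambda>p. f p * g p) \<in> BCL"
proof -
  obtain L where L: "L > 0" "\<And>x s t. 0 \<le> x \<Longrightarrow> x \<le> 1 \<Longrightarrow> \<bar>f (x, s) - f (x, t)\<bar> \<le> L * \<bar>s - t\<bar>"
    using BCL_E[OF assms(1)] by metis
  obtain M where M: "M > 0" "\<And>x s t. 0 \<le> x \<Longrightarrow> x \<le> 1 \<Longrightarrow> \<bar>g (x, s) - g (x, t)\<bar> \<le> M * \<bar>s - t\<bar>"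
    using BCL_E[OF assms(2)] by metis
  obtain F where F: "F > 0" "\<And>p. p \<in> strip \<Longrightarrow> norm (f p) \<le> F" using BC_bound_pos[OF BCL_BC[OF assms(1)]] by blast
  obtain G where G: "G > 0" "\<And>p. p \<in> strip \<Longrightarrow> norm (g p) \<le> G" using BC_bound_pos[OF BCL_BC[OF assms(2)]] by blast
  show ?thesis
  proof (rule BCL_I[of _ "F * M + L * G"])
    show "(\<lambda>p. f p * g p) \<in> BC"
      using assms by (intro BC_mult BCL_BC)
    fix x s t :: real assume x: "0 \<le> x" "x \<le> 1"
    have "f (x, s) * g (x, s) - f (x, t) * g (x, t)
        = f (x, s) * (g (x, s) - g (x, t)) + (f (x, s) - f (x, t)) * g (x, t)"
      by (simp add: algebra_simps)
    also have "\<bar>\<dots>\<bar> \<le> \<bar>f (x, s)\<bar> * \<bar>g (x, s) - g (x, t)\<bar> + \<bar>f (x, s) - f (x, t)\<bar> * \<bar>g (x, t)\<bar>"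
      by (metis abs_mult abs_triangle_ineq)
    also have "\<dots> \<le> F * (M * \<bar>s - t\<bar>) + (L * \<bar>s - t\<bar>) * G"
      using L M F(1) F(2)[of "(x,s)"] G(2)[of "(x,t)"] x
      by (intro add_mono mult_mono) (auto simp: strip_def)
    finally show "\<bar>f (x, s) * g (x, s) - f (x, t) * g (x, t)\<bar> \<le> (F * M + L * G) * \<bar>s - t\<bar>"
      by (simp add: algebra_simps)
  qed
qed

lemma BCL_sum: "finite I \<Longrightarrow> (\<And>i. i \<in> I \<Longrightarrow> f i \<in> BCL) \<Longrightarrow> (\<lambda>p. \<Sum>i\<in>I. f i p) \<in> BCL"
  by (induction I rule: finite_induct) (auto intro!: BCL_add BCL_const)

lemma BCL_prod: "finite I \<Longrightarrow> (\<And>i. i \<in> I \<Longrightarrow> f i \<in> BCL) \<Longrightarrow> (\<lambda>p. \<Prod>i\<in>I. f i p) \<in> BCL"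
  by (induction I rule: finite_induct) (auto intro!: BCL_mult BCL_const)

lemma BCL_inverse:
  assumes "f \<in> BCL" "l > 0" "\<And>p. p \<in> strip \<Longrightarrow> l \<le> \<bar>f p\<bar>"
  shows "(\<lambda>p. 1 / f p) \<in> BCL"
proof -
  obtain L where L: "L > 0" "\<And>x s t. 0 \<le> x \<Longrightarrow> x \<le> 1 \<Longrightarrow> \<bar>f (x, s) - f (x, t)\<bar> \<le> L * \<bar>s - t\<bar>"
    using BCL_E[OF assms(1)] by metis
  show ?thesis
  proof (rule BCL_I[of _ "L / (l * l)"])
    show "(\<lambda>p. 1 / f p) \<in> BC"
      using assms by (intro BC_inverse BCL_BC)
    fix x s t :: real assume x: "0 \<le> x" "x \<le> 1"
    have l: "l \<le> \<bar>f (x, s)\<bar>" "l \<le> \<bar>f (x, t)\<bar>"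
      using assms(3) x by (auto simp: strip_def)
    then have "f (x, s) \<noteq> 0" "f (x, t) \<noteq> 0"
      using assms(2) by auto
    then have "1 / f (x, s) - 1 / f (x, t) = (f (x, t) - f (x, s)) / (f (x, s) * f (x, t))"
      by (simp add: field_simps)
    then have "\<bar>1 / f (x, s) - 1 / f (x, t)\<bar> = \<bar>f (x, s) - f (x, t)\<bar> / (\<bar>f (x, s)\<bar> * \<bar>f (x, t)\<bar>)"
      by (simp add: abs_mult abs_minus_commute)
    also have "\<dots> \<le> (L * \<bar>s - t\<bar>) / (l * l)"
      using L(1) L(2)[OF x] l assms(2) by (intro frac_le mult_mono) auto
    finally show "\<bar>1 / f (x, s) - 1 / f (x, t)\<bar> \<le> L / (l * l) * \<bar>s - t\<bar>"
      by simp
  qed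
qed

text \<open>For fixed \<open>x\<close>, the mean value inequality in \<open>t\<close> turns the
  bound on \<open>dt f\<close> into a Lipschitz constant, and this constant is the same for all
  \<open>x\<close>.\<close>

lemma BC1_imp_BCL:
  assumes "f \<in> BC1"
  shows "f \<in> BCL"
proof -
  have f: "f \<in> BC" "dt f \<in> BC"
    and diff: "\<And>x t. (x, t) \<in> strip \<Longrightarrow> (\<lambda>\<tau>. f (x, \<tau>)) differentiable (at t)"
    using assms unfolding BC1_def by auto
  obtain L where L: "L > 0" "\<And>p. p \<in> strip \<Longrightarrow> norm (dt f p) \<le> L"
    using BC_bound_pos[OF f(2)] by blast
  show ?thesis
  proof (rule BCL_I[of _ L])
    fix x s t :: real assume x: "0 \<le> x" "x \<le> 1"
    have d: "((\<lambda>\<tau>. f (x, \<tau>)) has_field_derivative dt f (x, \<tau>)) (at \<tau> within UNIV)" for \<tau>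
      using diff[of x \<tau>] x
      by (simp add: strip_def dt_def vector_derivative_works has_real_derivative_iff_has_vector_derivative)
    show "\<bar>f (x, s) - f (x, t)\<bar> \<le> L * \<bar>s - t\<bar>"
      using field_differentiable_bound[OF convex_UNIV d, of L s t] L(2) x
      by (auto simp: strip_def)
  qed (rule f)
qed

lemma BCL_det:
  fixes A :: "real \<times> real \<Rightarrow> real ^ 'n ^ 'n"
  assumes "\<And>i j. (\<lambda>p. A p $ i $ j) \<in> BCL"
  shows "(\<lambda>p. det (A p)) \<in> BCL"
  unfolding det_def using assms by (intro BCL_sum BCL_mult BCL_prod BCL_const) auto

section \<open>Inverse matrices with regular entries\<close>

lemma matrix_inv_mult:
  fixes A :: "real ^ 'n ^ 'n"
  assumes "invertible A"
  shows "A ** matrix_inv A = mat 1" "matrix_inv A ** A = mat 1"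
  using someI_ex[OF assms[unfolded invertible_def]] unfolding matrix_inv_def by auto

text \<open>Column \<open>j\<close> of the inverse solves the linear system with right-hand side
  \<open>axis j 1\<close>, so Cramer's rule applies. The result is a polynomial in the entries times
  \<open>1 / det A\<close>, a form under which \<open>BCL\<close> is closed once the determinant
  stays away from zero.\<close>

lemma matrix_inv_cramer:
  fixes A :: "real ^ 'n ^ 'n"
  assumes "det A \<noteq> 0"
  shows "matrix_inv A $ i $ j
    = det (\<chi> r s. if s = i then (if r = j then 1 else 0) else A $ r $ s) * (1 / det A)"
proof -
  have "A ** matrix_inv A = mat 1"
    using assms by (simp add: matrix_inv_mult invertible_det_nz)
  then have "A *v (matrix_inv A *v axis j 1) = axis j 1"
    by (simp add: matrix_vector_mul_assoc)
  then have "matrix_inv A *v axis j 1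
      = (\<chi> k. det (\<chi> r s. if s = k then axis j 1 $ r else A $ r $ s) / det A)"
    using cramer[OF assms] by blast
  then have "(matrix_inv A *v axis j 1) $ i
      = det (\<chi> r s. if s = i then axis j 1 $ r else A $ r $ s) / det A"
    by simp
  then show ?thesis
    by (simp add: matrix_vector_mult_def axis_def if_distrib[of "(*) _"] cong: if_cong)
qed

lemma BCL_matrix_inv:
  fixes A :: "real \<times> real \<Rightarrow> real ^ 'n ^ 'n"
  assumes "\<And>i j. (\<lambda>p. A p $ i $ j) \<in> BCL" "l > 0" "\<And>p. p \<in> strip \<Longrightarrow> l \<le> \<bar>det (A p)\<bar>"
  shows "(\<lambda>p. matrix_inv (A p) $ i $ j) \<in> BCL"
proof -
  have "(\<lambda>p. det (\<chi> r s. if s = i then (if r = j then 1 else 0) else A p $ r $ s) * (1 / det (A p))) \<in> BCL"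
  proof (intro BCL_mult BCL_inverse BCL_det)
    fix r s
    show "(\<lambda>p. (\<chi> r s. if s = i then (if r = j then 1 else 0) else A p $ r $ s) $ r $ s) \<in> BCL"
      using assms(1) BCL_const by (cases "s = i") auto
  qed (use assms in auto)
  moreover have "matrix_inv (A p) $ i $ j
      = det (\<chi> r s. if s = i then (if r = j then 1 else 0) else A p $ r $ s) * (1 / det (A p))"
    if "p \<in> strip" for p
    using assms(2) assms(3)[OF that] by (intro matrix_inv_cramer) auto
  ultimately show ?thesis
    by (rule BCL_cong)
qed

section \<open>Characteristics\<close>

text \<open>Both \<open>C - G\<close> and \<open>C + G\<close> have a nonnegative derivative, hence
  are nondecreasing. This comparison replaces direct estimates of integrals in the Picard iteration,
  in Gronwall's inequality and in the bound for the integral equations.\<close>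

lemma abs_diff_le_of_deriv_dominated:
  fixes G C :: "real \<Rightarrow> real"
  assumes "a \<le> b"
    and G: "\<And>s. s \<in> {a..b} \<Longrightarrow> (G has_real_derivative G' s) (at s within {a..b})"
    and C: "\<And>s. s \<in> {a..b} \<Longrightarrow> (C has_real_derivative C' s) (at s within {a..b})"
    and le: "\<And>s. s \<in> {a..b} \<Longrightarrow> \<bar>G' s\<bar> \<le> C' s"
  shows "\<bar>G b - G a\<bar> \<le> C b - C a"
proof -
  have nondec: "F a \<le> F b"
    if F: "\<And>s. s \<in> {a..b} \<Longrightarrow> (F has_real_derivative F' s) (at s within {a..b})"
      and nn: "\<And>s. s \<in> {a..b} \<Longrightarrow> 0 \<le> F' s" for F F' :: "real \<Rightarrow> real"
  proof (rule DERIV_nonneg_imp_increasing_open[OF \<open>a \<le> b\<close>])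
    fix s assume s: "a < s" "s < b"
    then have "DERIV F s :> F' s"
      using F[of s] by (simp add: at_within_Icc_at)
    then show "\<exists>y. DERIV F s :> y \<and> 0 \<le> y"
      using nn[of s] s by auto
  next
    show "continuous_on {a..b} F"
      using F by (rule DERIV_continuous_on)
  qed
  have le': "G' s \<le> C' s" "0 \<le> C' s + G' s" if "s \<in> {a..b}" for s
    using le[OF that] by auto
  have "C a - G a \<le> C b - G b"
    by (rule nondec[where F = "\<lambda>s. C s - G s" and F' = "\<lambda>s. C' s - G' s"])
       (auto intro!: DERIV_diff C G le')
  moreover have "C a + G a \<le> C b + G b"
    by (rule nondec[where F = "\<lambda>s. C s + G s" and F' = "\<lambda>s. C' s + G' s"])
       (auto intro!: DERIV_add C G le')
  ultimately show ?thesis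
    by linarith
qed

text \<open>A form independent of the order of the end points, as needed for oriented integrals that
  start at either boundary line.\<close>

lemma abs_diff_le_of_deriv_dominated_unit:
  fixes G C :: "real \<Rightarrow> real"
  assumes x: "x \<in> {0..1}" "y \<in> {0..1}"
    and G: "\<And>s. s \<in> {0..1} \<Longrightarrow> (G has_real_derivative G' s) (at s within {0..1})"
    and C: "\<And>s. s \<in> {0..1} \<Longrightarrow> (C has_real_derivative C' s) (at s within {0..1})"
    and le: "\<And>s. s \<in> {0..1} \<Longrightarrow> \<bar>G' s\<bar> \<le> C' s"
  shows "\<bar>G x - G y\<bar> \<le> \<bar>C x - C y\<bar>"
proof -
  have "\<bar>G b - G a\<bar> \<le> C b - C a" if "a \<le> b" "a \<in> {0..1}" "b \<in> {0..1}" for a b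
  proof (rule abs_diff_le_of_deriv_dominated[OF \<open>a \<le> b\<close>])
    fix s assume s: "s \<in> {a..b}"
    then have s': "s \<in> {0..1}" and sub: "{a..b} \<subseteq> {0..1}"
      using that by auto
    show "(G has_real_derivative G' s) (at s within {a..b})"
      using DERIV_subset[OF G[OF s'] sub] .
    show "(C has_real_derivative C' s) (at s within {a..b})"
      using DERIV_subset[OF C[OF s'] sub] .
    show "\<bar>G' s\<bar> \<le> C' s"
      using le[OF s'] .
  qed
  from this[of x y] this[of y x] x show ?thesis
    by (cases "x \<le> y") auto
qed

section \<open>Solutions of scalar differential equations on the whole unit interval\<close>

lemma fixpoint_of_power_contraction:
  fixes F :: "'a::complete_space \<Rightarrow> 'a"
  assumes "0 \<le> c" "c < 1" "\<And>x y. dist ((F ^^ k) x) ((F ^^ k) y) \<le> c * dist x y"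
  shows "\<exists>x. F x = x"
proof -
  have "\<exists>!x. (F ^^ k) x = x"
    using assms by (intro banach_fix_type[of c]) auto
  then obtain x where x: "(F ^^ k) x = x" and unique: "\<And>y. (F ^^ k) y = y \<Longrightarrow> y = x"
    by blast
  \<comment> \<open>\<open>F\<close> commutes with its powers, so \<open>F x\<close> is also a fixed
    point of the contracting power; uniqueness then forces \<open>F x = x\<close>.\<close>
  have "(F ^^ k) (F x) = F x"
    using x by (metis funpow_swap1)
  then show ?thesis
    using unique by blast
qed

lemma DERIV_power_Suc_over_fact:
  fixes D :: real
  assumes "(g has_real_derivative g') (at s within S)"
  shows "((\<lambda>s. D * g s ^ Suc k / fact (Suc k)) has_real_derivative
    D * g s ^ k / fact k * g') (at s within S)"
proof -
  have "((\<lambda>s. (D / fact (Suc k)) * g s ^ Suc k) has_real_derivative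
      (D / fact (Suc k)) * ((1 + real k) * (g' * g s ^ k))) (at s within S)"
    by (rule DERIV_cmult) (use DERIV_power_Suc[OF assms, of k] in simp)
  also have "(D / fact (Suc k)) * ((1 + real k) * (g' * g s ^ k)) = D * g s ^ k / fact k * g'"
    by (simp add: divide_simps del: of_nat_Suc)
  finally show ?thesis
    by simp
qed

text \<open>The \<open>k\<close>-th power of the integral operator has Lipschitz constant at most
  \<open>L ^ k / fact k\<close> in the supremum norm, which is below 1 for large \<open>k\<close>. A
  solution on all of \<open>{0..1}\<close> thus arises at once, without gluing solutions on short
  intervals.\<close>

lemma picard_existence:
  fixes f :: "real \<times> real \<Rightarrow> real"
  assumes cont: "continuous_on strip f" and "L > 0"
    and lip: "\<And>\<xi> s t. 0 \<le> \<xi> \<Longrightarrow> \<xi> \<le> 1 \<Longrightarrow> \<bar>f (\<xi>, s) - f (\<xi>, t)\<bar> \<le> L * \<bar>s - t\<bar>"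
    and x: "x \<in> {0..1}"
  shows "\<exists>w. w x = t \<and> (\<forall>\<eta>\<in>{0..1}. (w has_real_derivative f (\<eta>, w \<eta>)) (at \<eta> within {0..1}))"
proof -
  \<comment> \<open>Precomposition with this retraction onto \<open>{0..1}\<close> lets the
    iteration act on bounded continuous functions on the line, which form a complete space.\<close>
  define cl :: "real \<Rightarrow> real" where "cl r = max 0 (min 1 r)" for r
  have cl: "cl r \<in> {0..1}" "r \<in> {0..1} \<Longrightarrow> cl r = r" for r
    by (auto simp: cl_def)
  \<comment> \<open>The difference of two integrals from 0 is the oriented integral from
    \<open>x\<close> to \<open>r\<close>, so both sides of the initial point are treated
    together.\<close>
  define \<Phi> :: "(real \<Rightarrow> real) \<Rightarrow> real \<Rightarrow> real" where
    "\<Phi> z r = t + (integral {0..r} (\<lambda>s. f (s, z s)) - integral {0..x} (\<lambda>s. f (s, z s)))" for z r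
  have deriv: "(\<Phi> z has_real_derivative f (r, z r)) (at r within {0..1})"
    if "continuous_on UNIV z" "r \<in> {0..1}" for z r
  proof -
    have "continuous_on {0..1} (\<lambda>s. f (s, z s))"
      by (rule continuous_on_compose2[OF cont])
         (auto simp: strip_def intro!: continuous_intros continuous_on_subset[OF that(1)])
    from integral_has_real_derivative[OF this that(2)] show ?thesis
      unfolding \<Phi>_def by (auto intro!: derivative_eq_intros)
  qed
  have \<Phi>_cont: "continuous_on {0..1} (\<Phi> z)" if "continuous_on UNIV z" for z
    by (rule DERIV_continuous_on[OF deriv[OF that]])
  define P where "P z = Bcontfun (\<lambda>r. \<Phi> (apply_bcontfun z) (cl r))" for z :: "real \<Rightarrow>\<^sub>C real"
  have P: "apply_bcontfun (P z) r = \<Phi> (apply_bcontfun z) (cl r)" for z r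
  proof -
    have c: "continuous_on {0..1} (\<Phi> (apply_bcontfun z))"
      by (rule \<Phi>_cont) simp
    have "continuous_on UNIV (\<lambda>r. \<Phi> (apply_bcontfun z) (cl r))"
      by (rule continuous_on_compose2[OF c]) (auto simp: cl_def intro!: continuous_intros)
    moreover have "bounded (range (\<lambda>r. \<Phi> (apply_bcontfun z) (cl r)))"
      by (rule bounded_subset[OF compact_imp_bounded[OF compact_continuous_image[OF c compact_Icc]]])
         (use cl in auto)
    ultimately have "(\<lambda>r. \<Phi> (apply_bcontfun z) (cl r)) \<in> bcontfun"
      unfolding bcontfun_def by simp
    then show ?thesis
      unfolding P_def by (simp add: Bcontfun_inverse)
  qed
  have \<Phi>x: "\<Phi> z x = t" for z
    by (simp add: \<Phi>_def)
  \<comment> \<open>The distance of \<open>cl r\<close> from \<open>x\<close> must stay in the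
    bound: integrating its \<open>k\<close>-th power is what produces the factorial. It is estimated
    by 1 only at the end.\<close>
  have pow: "\<bar>apply_bcontfun ((P ^^ k) z) r - apply_bcontfun ((P ^^ k) z') r\<bar>
      \<le> dist z z' * (L * \<bar>cl r - x\<bar>) ^ k / fact k" for k z z' r
  proof (induction k arbitrary: r)
    case 0
    then show ?case
      using dist_bounded[of z r z'] by (simp add: dist_real_def)
  next
    case (Suc k)
    let ?D = "dist z z'"
    let ?v = "apply_bcontfun ((P ^^ k) z)" and ?v' = "apply_bcontfun ((P ^^ k) z')"
    define G where "G = (\<lambda>s. \<Phi> ?v s - \<Phi> ?v' s)"
    have G: "(G has_real_derivative f (s, ?v s) - f (s, ?v' s)) (at s within {0..1})"
      if "s \<in> {0..1}" for s
      unfolding G_def using that by (intro DERIV_diff deriv) auto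
    have G': "\<bar>f (s, ?v s) - f (s, ?v' s)\<bar> \<le> ?D * (L * \<bar>s - x\<bar>) ^ k / fact k * L"
      if s: "s \<in> {0..1}" for s
    proof -
      have "\<bar>f (s, ?v s) - f (s, ?v' s)\<bar> \<le> L * \<bar>?v s - ?v' s\<bar>"
        using s by (intro lip) auto
      also have "\<dots> \<le> L * (?D * (L * \<bar>s - x\<bar>) ^ k / fact k)"
        using Suc[of s] cl(2)[OF s] \<open>L > 0\<close> by (intro mult_left_mono) auto
      finally show ?thesis
        by (simp add: mult_ac)
    qed
    have "\<bar>G \<rho>\<bar> \<le> ?D * (L * \<bar>\<rho> - x\<bar>) ^ Suc k / fact (Suc k)" if \<rho>: "\<rho> \<in> {0..1}" for \<rho>
    proof (cases "x \<le> \<rho>")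
      case True
      have sub: "s \<in> {0..1}" "{x..\<rho>} \<subseteq> {0..1}" if "s \<in> {x..\<rho>}" for s
        using that \<rho> x by auto
      define C where "C = (\<lambda>s. ?D * (L * (s - x)) ^ Suc k / fact (Suc k))"
      have "\<bar>G \<rho> - G x\<bar> \<le> C \<rho> - C x"
      proof (rule abs_diff_le_of_deriv_dominated[OF True])
        fix s assume s: "s \<in> {x..\<rho>}"
        show "(G has_real_derivative f (s, ?v s) - f (s, ?v' s)) (at s within {x..\<rho>})"
          by (rule DERIV_subset[OF G[OF sub(1)[OF s]] sub(2)[OF s]])
        show "(C has_real_derivative ?D * (L * (s - x)) ^ k / fact k * L) (at s within {x..\<rho>})"
          unfolding C_def
          by (rule DERIV_power_Suc_over_fact) (auto intro!: derivative_eq_intros)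
        show "\<bar>f (s, ?v s) - f (s, ?v' s)\<bar> \<le> ?D * (L * (s - x)) ^ k / fact k * L"
          using G'[OF sub(1)[OF s]] s by simp
      qed
      then show ?thesis
        using True by (simp add: G_def C_def \<Phi>x)
    next
      case False
      then have le: "\<rho> \<le> x" by simp
      have sub: "s \<in> {0..1}" "{\<rho>..x} \<subseteq> {0..1}" if "s \<in> {\<rho>..x}" for s
        using that \<rho> x by auto
      \<comment> \<open>To the left of \<open>x\<close> the distance \<open>x - s\<close> decreases
        in \<open>s\<close>, so the comparison function needs the opposite sign to be
        increasing.\<close>
      define C where "C = (\<lambda>s. (- ?D) * (L * (x - s)) ^ Suc k / fact (Suc k))"
      have "\<bar>G x - G \<rho>\<bar> \<le> C x - C \<rho>"
      proof (rule abs_diff_le_of_deriv_dominated[OF le])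
        fix s assume s: "s \<in> {\<rho>..x}"
        show "(G has_real_derivative f (s, ?v s) - f (s, ?v' s)) (at s within {\<rho>..x})"
          by (rule DERIV_subset[OF G[OF sub(1)[OF s]] sub(2)[OF s]])
        show "(C has_real_derivative ?D * (L * (x - s)) ^ k / fact k * L) (at s within {\<rho>..x})"
          unfolding C_def
          by (rule DERIV_cong[OF DERIV_power_Suc_over_fact[where g' = "- L"]])
             (auto intro!: derivative_eq_intros)
        show "\<bar>f (s, ?v s) - f (s, ?v' s)\<bar> \<le> ?D * (L * (x - s)) ^ k / fact k * L"
          using G'[OF sub(1)[OF s]] s by simp
      qed
      then show ?thesis
        using False by (simp add: G_def C_def \<Phi>x)
    qed
    from this[OF cl(1)[of r]] show ?case
      by (simp add: P G_def)
  qed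
  have "(\<lambda>k. inverse (fact k) * L ^ k) \<longlonglongrightarrow> 0"
    by (rule summable_LIMSEQ_zero[OF summable_exp])
  then have "eventually (\<lambda>k. inverse (fact k) * L ^ k < 1) sequentially"
    by (rule order_tendstoD) simp
  then obtain k where k: "inverse (fact k) * L ^ k < 1"
    by (auto simp: eventually_sequentially)
  have "\<exists>z. P z = z"
  proof (rule fixpoint_of_power_contraction[OF _ k])
    fix z z'
    show "dist ((P ^^ k) z) ((P ^^ k) z') \<le> inverse (fact k) * L ^ k * dist z z'"
    proof (rule dist_bound)
      fix r
      have "\<bar>cl r - x\<bar> \<le> 1"
        using cl(1)[of r] x by auto
      then have "(L * \<bar>cl r - x\<bar>) ^ k \<le> L ^ k"
        using \<open>L > 0\<close> by (intro power_mono) (auto intro: mult_left_le)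
      then have "dist z z' * (L * \<bar>cl r - x\<bar>) ^ k / fact k \<le> dist z z' * L ^ k / fact k"
        by (intro divide_right_mono mult_left_mono) auto
      with pow[of k z r z']
      show "dist (apply_bcontfun ((P ^^ k) z) r) (apply_bcontfun ((P ^^ k) z') r)
          \<le> inverse (fact k) * L ^ k * dist z z'"
        by (simp add: dist_real_def field_simps)
    qed
  qed (use \<open>L > 0\<close> in simp)
  then obtain z where z: "P z = z" ..
  have fixed: "\<Phi> (apply_bcontfun z) r = apply_bcontfun z r" if "r \<in> {0..1}" for r
    using P[of z r] z cl(2)[OF that] by simp
  show ?thesis
  proof (intro exI[of _ "\<Phi> (apply_bcontfun z)"] conjI ballI)
    fix \<eta> :: real assume \<eta>: "\<eta> \<in> {0..1}"
    show "(\<Phi> (apply_bcontfun z) has_real_derivative f (\<eta>, \<Phi> (apply_bcontfun z) \<eta>)) (at \<eta> within {0..1})"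
      using deriv[of "apply_bcontfun z" \<eta>] \<eta> by (simp add: fixed)
  qed (rule \<Phi>x)
qed

text \<open>The squared difference \<open>E\<close> is differentiable and satisfies
  \<open>\<bar>E'\<bar> \<le> 2 * L * E\<close>. Hence \<open>E\<close> times
  \<open>exp (- 2 * L * s)\<close> decreases and \<open>E\<close> times
  \<open>exp (2 * L * s)\<close> increases, which covers both directions in time. As the interval
  has length 1, a square root leaves the factor \<open>exp L\<close>.\<close>

lemma characteristics_gronwall:
  fixes f :: "real \<times> real \<Rightarrow> real"
  assumes lip: "\<And>\<xi> s t. 0 \<le> \<xi> \<Longrightarrow> \<xi> \<le> 1 \<Longrightarrow> \<bar>f (\<xi>, s) - f (\<xi>, t)\<bar> \<le> L * \<bar>s - t\<bar>"
    and v: "\<And>\<eta>. \<eta> \<in> {0..1} \<Longrightarrow> (v has_real_derivative f (\<eta>, v \<eta>)) (at \<eta> within {0..1})"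
    and w: "\<And>\<eta>. \<eta> \<in> {0..1} \<Longrightarrow> (w has_real_derivative f (\<eta>, w \<eta>)) (at \<eta> within {0..1})"
    and x: "x \<in> {0..1}" "y \<in> {0..1}" and "L > 0"
  shows "\<bar>v y - w y\<bar> \<le> exp L * \<bar>v x - w x\<bar>"
proof -
  define E where "E \<eta> = (v \<eta> - w \<eta>)\<^sup>2" for \<eta>
  define E' where "E' \<eta> = 2 * (v \<eta> - w \<eta>) * (f (\<eta>, v \<eta>) - f (\<eta>, w \<eta>))" for \<eta>
  have E: "(E has_real_derivative E' \<eta>) (at \<eta> within {0..1})" if "\<eta> \<in> {0..1}" for \<eta>
    unfolding E_def E'_def using v[OF that] w[OF that] by (auto intro!: derivative_eq_intros)
  have E'_le: "\<bar>E' \<eta>\<bar> \<le> 2 * L * E \<eta>" if "\<eta> \<in> {0..1}" for \<eta>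
  proof -
    have "\<bar>E' \<eta>\<bar> = 2 * \<bar>v \<eta> - w \<eta>\<bar> * \<bar>f (\<eta>, v \<eta>) - f (\<eta>, w \<eta>)\<bar>"
      by (simp only: E'_def abs_mult abs_numeral)
    also have "\<dots> \<le> 2 * \<bar>v \<eta> - w \<eta>\<bar> * (L * \<bar>v \<eta> - w \<eta>\<bar>)"
      using that by (intro mult_left_mono lip) auto
    finally show ?thesis
      unfolding E_def power2_abs[symmetric, of "v \<eta> - w \<eta>"] power2_eq_square
      by (simp only: mult_ac)
  qed
  have "E y \<le> exp (2 * L) * E x"
  proof -
    \<comment> \<open>The value \<open>\<sigma> = - 1\<close> is the forward and
      \<open>\<sigma> = 1\<close> the backward comparison. Since the square of
      \<open>\<sigma>\<close> is 1, the derivative of \<open>H\<close> has the sign of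
      \<open>\<sigma> * E' + 2 * L * E\<close>, which is nonnegative in both cases.\<close>
    have mono: "E b * exp (\<sigma> * (2 * L * b)) \<le> E a * exp (\<sigma> * (2 * L * a))"
      if ab: "a \<in> {0..1}" "b \<in> {0..1}" and \<sigma>: "\<sigma> = - 1 \<and> a \<le> b \<or> \<sigma> = 1 \<and> b \<le> a" for a b \<sigma>
    proof -
      define H where "H \<eta> = \<sigma> * (E \<eta> * exp (\<sigma> * (2 * L * \<eta>)))" for \<eta>
      define H' where "H' \<eta> = \<sigma> * (E' \<eta> + \<sigma> * (2 * L) * E \<eta>) * exp (\<sigma> * (2 * L * \<eta>))" for \<eta>
      have H: "(H has_real_derivative H' \<eta>) (at \<eta> within {0..1})" if "\<eta> \<in> {0..1}" for \<eta>
        unfolding H_def H'_def using E[OF that]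
        by (auto intro!: derivative_eq_intros simp: algebra_simps)
      have H'_nn: "0 \<le> H' \<eta>" if "\<eta> \<in> {0..1}" for \<eta>
      proof -
        have "0 \<le> \<sigma> * (E' \<eta> + \<sigma> * (2 * L) * E \<eta>)"
          using E'_le[OF that] \<sigma> by auto
        then show ?thesis
          unfolding H'_def by simp
      qed
      have mono: "H r \<le> H s" if rs: "r \<le> s" "r \<in> {0..1}" "s \<in> {0..1}" for r s
      proof -
        have "\<bar>(\<lambda>_. 0 :: real) s - (\<lambda>_. 0) r\<bar> \<le> H s - H r"
        proof (rule abs_diff_le_of_deriv_dominated[OF \<open>r \<le> s\<close>, where G' = "\<lambda>_. 0" and C' = H'])
          fix \<eta> assume "\<eta> \<in> {r..s}"
          then have \<eta>: "\<eta> \<in> {0..1}" "{r..s} \<subseteq> {0..1}"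
            using rs by auto
          show "(H has_real_derivative H' \<eta>) (at \<eta> within {r..s})"
            by (rule DERIV_subset[OF H[OF \<eta>(1)] \<eta>(2)])
          show "\<bar>0\<bar> \<le> H' \<eta>"
            using H'_nn[OF \<eta>(1)] by simp
        qed simp
        then show ?thesis by simp
      qed
      show ?thesis
        using \<sigma> mono[of a b] mono[of b a] ab by (auto simp: H_def)
    qed
    have En: "0 \<le> E x"
      by (simp add: E_def)
    have "E y \<le> E x * exp (2 * L * \<bar>y - x\<bar>)"
    proof (cases "x \<le> y")
      case True
      have "E y * exp (- (2 * L * y)) \<le> E x * exp (- (2 * L * x))"
        using mono[of x y "- 1"] True x by simp
      then have "E y * exp (- (2 * L * y)) * exp (2 * L * y) \<le> E x * exp (- (2 * L * x)) * exp (2 * L * y)"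
        by (rule mult_right_mono) simp
      then show ?thesis
        using True by (simp add: mult.assoc exp_add[symmetric] algebra_simps)
    next
      case False
      have "E y * exp (2 * L * y) \<le> E x * exp (2 * L * x)"
        using mono[of x y 1] False x by simp
      then have "E y * exp (2 * L * y) * exp (- (2 * L * y)) \<le> E x * exp (2 * L * x) * exp (- (2 * L * y))"
        by (rule mult_right_mono) simp
      then show ?thesis
        using False by (simp add: mult.assoc exp_add[symmetric] algebra_simps)
    qed
    also have "\<dots> \<le> E x * exp (2 * L)"
      using En x \<open>L > 0\<close> by (intro mult_left_mono) auto
    finally show ?thesis
      by (simp add: mult.commute)
  qed
  also have "\<dots> = (exp L * \<bar>v x - w x\<bar>)\<^sup>2"
    by (simp add: E_def power_mult_distrib exp_double)
  finally have "(v y - w y)\<^sup>2 \<le> (exp L * \<bar>v x - w x\<bar>)\<^sup>2"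
    by (simp add: E_def)
  then have "\<bar>v y - w y\<bar>\<^sup>2 \<le> (exp L * \<bar>v x - w x\<bar>)\<^sup>2"
    by (simp only: power2_abs)
  then show ?thesis
    by (rule power2_le_imp_le) simp
qed

section \<open>Oriented integrals of continuous functions over parts of the unit interval\<close>

lemma LBINT_unit_eq:
  fixes f :: "real \<Rightarrow> real"
  assumes f: "continuous_on {0..1} f" and x: "x \<in> {0..1}" "y \<in> {0..1}"
  shows "(LBINT s=ereal x..ereal y. f s) = integral {0..y} f - integral {0..x} f"
proof (rule interval_integral_FTC_finite)
  have sub: "{min x y..max x y} \<subseteq> {0..1}"
    using x by auto
  then show "continuous_on {min x y..max x y} f"
    using f continuous_on_subset by blast
  fix s assume "min x y \<le> s" "s \<le> max x y"
  then have "s \<in> {0..1}"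
    using x by auto
  then show "((\<lambda>y. integral {0..y} f) has_vector_derivative f s) (at s within {min x y..max x y})"
    by (rule has_vector_derivative_within_subset[OF integral_has_vector_derivative[OF f] sub])
qed

lemma DERIV_LBINT_unit:
  fixes f :: "real \<Rightarrow> real"
  assumes f: "continuous_on {0..1} f" and x: "x \<in> {0..1}" "y \<in> {0..1}"
  shows "((\<lambda>y. LBINT s=ereal x..ereal y. f s) has_real_derivative f y) (at y within {0..1})"
proof (rule has_field_derivative_transform_within[OF _ zero_less_one x(2)])
  show "((\<lambda>y. integral {0..y} f - integral {0..x} f) has_real_derivative f y) (at y within {0..1})"
    using integral_has_real_derivative[OF f x(2)] by (auto intro!: derivative_eq_intros)
qed (simp add: LBINT_unit_eq[OF f x(1)])

text \<open>The substitution \<open>s = x + r * (y - x)\<close> moves the end points into the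
  integrand, also when they coincide or are reversed. Continuity in variable end points then reduces
  to continuity of a parameter integral over a fixed interval.\<close>

lemma LBINT_unit_rescaled:
  fixes f :: "real \<Rightarrow> real"
  assumes f: "continuous_on {0..1} f" and x: "x \<in> {0..1}" "y \<in> {0..1}"
  shows "(LBINT s=ereal x..ereal y. f s) = integral {0..1} (\<lambda>r. (y - x) * f (x + r * (y - x)))"
proof -
  let ?F = "\<lambda>y. integral {0..y} f"
  have in_unit: "x + r * (y - x) \<in> {0..1}" if "r \<in> {0..1}" for r
  proof -
    have "x + r * (y - x) = (1 - r) *\<^sub>R x + r *\<^sub>R y"
      by (simp add: algebra_simps)
    also have "\<dots> \<in> {0..1}"
      using that x by (intro convexD[OF convex_real_interval(5)]) auto
    finally show ?thesis .
  qed
  have "((\<lambda>r. (y - x) * f (x + r * (y - x))) has_integral ?F (x + 1 * (y - x)) - ?F (x + 0 * (y - x))) {0..1}"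
  proof (rule fundamental_theorem_of_calculus)
    fix r :: real assume r: "r \<in> {0..1}"
    have "((\<lambda>r. ?F (x + r * (y - x))) has_real_derivative f (x + r * (y - x)) * (y - x)) (at r within {0..1})"
    proof (rule DERIV_image_chain[where f = ?F, unfolded o_def])
      show "((\<lambda>r. x + r * (y - x)) has_real_derivative y - x) (at r within {0..1})"
        by (auto intro!: derivative_eq_intros)
      show "(?F has_real_derivative f (x + r * (y - x)))
          (at (x + r * (y - x)) within (\<lambda>r. x + r * (y - x)) ` {0..1})"
        by (rule DERIV_subset[OF integral_has_real_derivative[OF f in_unit[OF r]]])
           (use in_unit in blast)
    qed
    then show "((\<lambda>r. ?F (x + r * (y - x))) has_vector_derivative (y - x) * f (x + r * (y - x))) (at r within {0..1})"
      by (simp add: has_real_derivative_iff_has_vector_derivative mult.commute)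
  qed simp
  then show ?thesis
    unfolding LBINT_unit_eq[OF f x] by (simp add: integral_unique del: integral_mult_right)
qed

lemma continuous_on_LBINT_unit:
  fixes f :: "'a::topological_space \<Rightarrow> real \<Rightarrow> real"
  assumes f: "continuous_on (S \<times> {0..1}) (\<lambda>(p, s). f p s)"
    and ends: "continuous_on S \<alpha>" "continuous_on S \<beta>"
      "\<And>p. p \<in> S \<Longrightarrow> \<alpha> p \<in> {0..1}" "\<And>p. p \<in> S \<Longrightarrow> \<beta> p \<in> {0..1}"
  shows "continuous_on S (\<lambda>p. LBINT s=ereal (\<alpha> p)..ereal (\<beta> p). f p s)"
proof -
  have f1: "continuous_on {0..1} (f p)" if "p \<in> S" for p
  proof -
    have "continuous_on {0..1} (\<lambda>s. (\<lambda>(p, s). f p s) (p, s))"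
      by (rule continuous_on_compose2[OF f]) (use that in \<open>auto intro!: continuous_intros\<close>)
    then show ?thesis by simp
  qed
  have in_unit: "\<alpha> p + r * (\<beta> p - \<alpha> p) \<in> {0..1}" if "p \<in> S" "r \<in> {0..1}" for p r
  proof -
    have "\<alpha> p + r * (\<beta> p - \<alpha> p) = (1 - r) *\<^sub>R \<alpha> p + r *\<^sub>R \<beta> p"
      by (simp add: algebra_simps)
    also have "\<dots> \<in> {0..1}"
      using that ends(3,4) by (intro convexD[OF convex_real_interval(5)]) auto
    finally show ?thesis .
  qed
  have pf: "continuous_on (S \<times> {0..1}) (\<lambda>z. \<alpha> (fst z))" "continuous_on (S \<times> {0..1}) (\<lambda>z. \<beta> (fst z))"
    by (rule continuous_on_compose2[OF ends(1)] continuous_on_compose2[OF ends(2)];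
        auto intro!: continuous_intros)+
  have "continuous_on (S \<times> {0..1})
      (\<lambda>z. (\<lambda>(p, s). f p s) (fst z, \<alpha> (fst z) + snd z * (\<beta> (fst z) - \<alpha> (fst z))))"
    by (rule continuous_on_compose2[OF f]) (use in_unit in \<open>auto intro!: continuous_intros pf\<close>)
  then have "continuous_on (S \<times> cbox 0 1)
      (\<lambda>(p, r). (\<beta> p - \<alpha> p) * f p (\<alpha> p + r * (\<beta> p - \<alpha> p)))"
    by (auto simp: case_prod_unfold intro!: continuous_intros pf)
  from integral_continuous_on_param[OF this]
  have "continuous_on S (\<lambda>p. integral {0..1} (\<lambda>r. (\<beta> p - \<alpha> p) * f p (\<alpha> p + r * (\<beta> p - \<alpha> p))))"
    by simp
  then show ?thesis
    by (subst continuous_on_cong[OF refl LBINT_unit_rescaled[OF f1 ends(3,4)]])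
qed

lemma LBINT_unit_combine:
  fixes f :: "real \<Rightarrow> real"
  assumes f: "continuous_on {0..1} f" and x: "x \<in> {0..1}" "y \<in> {0..1}" "z \<in> {0..1}"
  shows "(LBINT s=ereal x..ereal y. f s) + (LBINT s=ereal y..ereal z. f s) = (LBINT s=ereal x..ereal z. f s)"
  by (simp add: LBINT_unit_eq[OF f x(1,2)] LBINT_unit_eq[OF f x(2,3)] LBINT_unit_eq[OF f x(1,3)])

lemma LBINT_unit_cong:
  fixes f g :: "real \<Rightarrow> real"
  assumes "x \<in> {0..1}" "y \<in> {0..1}" "\<And>s. s \<in> {0..1} \<Longrightarrow> f s = g s"
  shows "(LBINT s=ereal x..ereal y. f s) = (LBINT s=ereal x..ereal y. g s)"
  using assms by (intro interval_integral_cong) (auto simp: einterval_def min_def max_def split: if_splits)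

text \<open>The characteristics are parametrized by \<open>x\<close>, so only the reciprocals of the speeds enter.\<close>

locale transport =
  fixes a :: "'n::{finite, linorder} \<Rightarrow> real \<times> real \<Rightarrow> real" and b :: "'n mat_fun"
  assumes inv_speed: "\<And>j. (\<lambda>p. 1 / a j p) \<in> BCL"
    and coeff: "\<And>j k. (\<lambda>p. b p $ j $ k) \<in> BC"
begin

section \<open>The flow of characteristics\<close>

lemma omega_spec:
  assumes "x \<in> {0..1}"
  shows "omega a j x x t = t"
    and "\<eta> \<in> {0..1} \<Longrightarrow> ((\<lambda>\<eta>. omega a j \<eta> x t) has_real_derivative 1 / a j (\<eta>, omega a j \<eta> x t)) (at \<eta> within {0..1})"
proof -
  let ?P = "\<lambda>w. w x = t \<and>
    (\<forall>\<eta>\<in>{0..1}. (w has_real_derivative 1 / a j (\<eta>, w \<eta>)) (at \<eta> within {0..1}))"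
  obtain L where L: "L > 0"
    "\<And>\<xi> s t. 0 \<le> \<xi> \<Longrightarrow> \<xi> \<le> 1 \<Longrightarrow> \<bar>1 / a j (\<xi>, s) - 1 / a j (\<xi>, t)\<bar> \<le> L * \<bar>s - t\<bar>"
    using BCL_E[OF inv_speed[of j]] by metis
  have "continuous_on strip (\<lambda>p. 1 / a j p)"
    using BCL_BC[OF inv_speed[of j]] unfolding BC_iff by blast
  \<comment> \<open>\<open>omega\<close> is defined by choice, so its initial condition and
    differential equation become available only through existence of a solution on the full unit
    interval.\<close>
  from picard_existence[OF this L assms] have "\<exists>w. ?P w"
    by blast
  then have some: "?P (SOME w. ?P w)"
    by (rule someI_ex)
  have "(\<lambda>\<eta>. omega a j \<eta> x t) = (SOME w. ?P w)"
    unfolding omega_def ..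
  then have "?P (\<lambda>\<eta>. omega a j \<eta> x t)"
    by (rule ssubst[where P = ?P]) (rule some)
  then show "omega a j x x t = t"
    and "\<eta> \<in> {0..1} \<Longrightarrow> ((\<lambda>\<eta>. omega a j \<eta> x t) has_real_derivative 1 / a j (\<eta>, omega a j \<eta> x t)) (at \<eta> within {0..1})"
    by auto
qed

text \<open>The two characteristics may have different base points and are compared at any
  \<open>y\<close>. With equal values at \<open>y\<close> this is uniqueness; with nearby values it
  is Lipschitz dependence on the data.\<close>

lemma omega_gronwall:
  obtains C where "C > 0" "\<And>x x' y \<xi> t t'. x \<in> {0..1} \<Longrightarrow> x' \<in> {0..1} \<Longrightarrow> y \<in> {0..1} \<Longrightarrow> \<xi> \<in> {0..1} \<Longrightarrow>
    \<bar>omega a j \<xi> x t - omega a j \<xi> x' t'\<bar> \<le> C * \<bar>omega a j y x t - omega a j y x' t'\<bar>"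
proof -
  obtain L where L: "L > 0"
    "\<And>\<xi> s t. 0 \<le> \<xi> \<Longrightarrow> \<xi> \<le> 1 \<Longrightarrow> \<bar>1 / a j (\<xi>, s) - 1 / a j (\<xi>, t)\<bar> \<le> L * \<bar>s - t\<bar>"
    using BCL_E[OF inv_speed[of j]] by metis
  show ?thesis
  proof (rule that[of "exp L"])
    fix x x' y \<xi> t t' :: real
    assume "x \<in> {0..1}" "x' \<in> {0..1}" "y \<in> {0..1}" "\<xi> \<in> {0..1}"
    then show "\<bar>omega a j \<xi> x t - omega a j \<xi> x' t'\<bar> \<le> exp L * \<bar>omega a j y x t - omega a j y x' t'\<bar>"
      by (intro characteristics_gronwall[where f = "\<lambda>p. 1 / a j p"] L omega_spec(2))
  qed simp
qed

text \<open>Both sides are characteristics with the same value at \<open>y\<close>, so the Gronwall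
  estimate has right-hand side zero.\<close>

lemma omega_flow:
  assumes "x \<in> {0..1}" "y \<in> {0..1}" "\<xi> \<in> {0..1}"
  shows "omega a j \<xi> y (omega a j y x t) = omega a j \<xi> x t"
proof -
  obtain C where C: "\<And>x x' y \<xi> t t'. x \<in> {0..1} \<Longrightarrow> x' \<in> {0..1} \<Longrightarrow> y \<in> {0..1} \<Longrightarrow> \<xi> \<in> {0..1} \<Longrightarrow>
    \<bar>omega a j \<xi> x t - omega a j \<xi> x' t'\<bar> \<le> C * \<bar>omega a j y x t - omega a j y x' t'\<bar>"
    using omega_gronwall[of j] by metis
  show ?thesis
    using C[OF assms(2,1,2,3), of "omega a j y x t" t] assms by (simp add: omega_spec)
qed

text \<open>The map is jointly Lipschitz. In \<open>\<xi>\<close> the constant is a bound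
  \<open>M\<close> of the reciprocal speed. For a change of base point, both characteristics are
  compared at \<open>x'\<close>: there they differ by at most
  \<open>M * \<bar>x - x'\<bar> + \<bar>t - t'\<bar>\<close>, and Gronwall's inequality propagates
  this to all \<open>\<xi>\<close>.\<close>

lemma continuous_on_omega:
  "continuous_on ({0..1} \<times> strip) (\<lambda>(\<xi>, x, t). omega a j \<xi> x t)"
proof -
  obtain C where C: "C > 0" "\<And>x x' y \<xi> t t'. x \<in> {0..1} \<Longrightarrow> x' \<in> {0..1} \<Longrightarrow> y \<in> {0..1} \<Longrightarrow> \<xi> \<in> {0..1} \<Longrightarrow>
    \<bar>omega a j \<xi> x t - omega a j \<xi> x' t'\<bar> \<le> C * \<bar>omega a j y x t - omega a j y x' t'\<bar>"
    using omega_gronwall[of j] by metis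
  obtain M where M: "M > 0" "\<And>p. p \<in> strip \<Longrightarrow> norm (1 / a j p) \<le> M"
    using BC_bound_pos[OF BCL_BC[OF inv_speed[of j]]] by blast
  have lip: "\<bar>omega a j \<xi> x t - omega a j \<xi>' x t\<bar> \<le> M * \<bar>\<xi> - \<xi>'\<bar>"
    if "x \<in> {0..1}" "\<xi> \<in> {0..1}" "\<xi>' \<in> {0..1}" for \<xi> \<xi>' x t
  proof -
    have "norm (omega a j \<xi> x t - omega a j \<xi>' x t) \<le> M * norm (\<xi> - \<xi>')"
      by (rule field_differentiable_bound[of "{0..1}" "\<lambda>\<xi>. omega a j \<xi> x t"
            "\<lambda>\<eta>. 1 / a j (\<eta>, omega a j \<eta> x t)"])
         (use that M(2) in \<open>auto intro!: omega_spec(2) simp: mem_strip\<close>)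
    then show ?thesis by simp
  qed
  have "(M + C * (M + 1))-lipschitz_on ({0..1} \<times> strip) (\<lambda>(\<xi>, x, t). omega a j \<xi> x t)"
  proof (rule lipschitz_onI, clarify)
    fix \<xi> x t \<xi>' x' t' :: real
    assume "(x, t) \<in> strip" "(x', t') \<in> strip" and \<xi>: "\<xi> \<in> {0..1}" "\<xi>' \<in> {0..1}"
    then have x: "x \<in> {0..1}" "x' \<in> {0..1}"
      by (auto simp: mem_strip)
    let ?d = "dist (\<xi>, x, t) (\<xi>', x', t')"
    have d: "\<bar>\<xi> - \<xi>'\<bar> \<le> ?d" "\<bar>x - x'\<bar> \<le> ?d" "\<bar>t - t'\<bar> \<le> ?d"
      using dist_fst_le[of "(\<xi>, x, t)" "(\<xi>', x', t')"] dist_snd_le[of "(\<xi>, x, t)" "(\<xi>', x', t')"]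
        dist_fst_le[of "(x, t)" "(x', t')"] dist_snd_le[of "(x, t)" "(x', t')"]
      by (auto simp: dist_real_def)
    have "\<bar>omega a j x' x t - t\<bar> \<le> M * \<bar>x' - x\<bar>"
      using lip[of x x' x t] x by (simp add: omega_spec(1))
    then have "\<bar>omega a j x' x t - t'\<bar> \<le> M * \<bar>x - x'\<bar> + \<bar>t - t'\<bar>"
      by (simp add: abs_minus_commute)
    also have "\<dots> \<le> M * ?d + ?d"
      using d M(1) by (intro add_mono mult_left_mono) auto
    finally have "C * \<bar>omega a j x' x t - t'\<bar> \<le> C * (M * ?d + ?d)"
      using C(1) by (intro mult_left_mono) auto
    then have 1: "\<bar>omega a j \<xi>' x t - omega a j \<xi>' x' t'\<bar> \<le> C * (M * ?d + ?d)"
      using C(2)[of x x' x' \<xi>' t t'] x \<xi> by (simp add: omega_spec(1))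
    have 2: "\<bar>omega a j \<xi> x t - omega a j \<xi>' x t\<bar> \<le> M * ?d"
      using lip[OF x(1) \<xi>, of t] mult_left_mono[OF d(1), of M] M(1) by linarith
    show "dist (omega a j \<xi> x t) (omega a j \<xi>' x' t') \<le> (M + C * (M + 1)) * ?d"
      using 1 2 by (simp add: dist_real_def algebra_simps)
  qed (use C M in auto)
  then show ?thesis
    by (rule lipschitz_on_continuous_on)
qed

lemma continuous_on_along_characteristics:
  assumes "continuous_on strip f"
  shows "continuous_on ({0..1} \<times> strip) (\<lambda>(\<xi>, x, t). f (\<xi>, omega a j \<xi> x t))"
proof -
  have "continuous_on ({0..1} \<times> strip) (\<lambda>z. f (fst z, (\<lambda>(\<xi>, x, t). omega a j \<xi> x t) z))"
    by (rule continuous_on_compose2[OF assms])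
       (auto intro!: continuous_intros continuous_on_omega simp: mem_strip)
  then show ?thesis
    by (simp add: case_prod_unfold)
qed

lemma continuous_on_along_characteristic:
  assumes "continuous_on strip f" "x \<in> {0..1}"
  shows "continuous_on {0..1} (\<lambda>\<xi>. f (\<xi>, omega a j \<xi> x t))"
proof -
  have "continuous_on {0..1} (\<lambda>\<xi>. (\<lambda>(\<xi>, x, t). f (\<xi>, omega a j \<xi> x t)) (\<xi>, x, t))"
    by (rule continuous_on_compose2[OF continuous_on_along_characteristics[OF assms(1)]])
       (use assms(2) in \<open>auto intro!: continuous_intros simp: mem_strip\<close>)
  then show ?thesis by simp
qed

lemma continuous_on_inv_speed: "continuous_on strip (\<lambda>p. 1 / a j p)"
  using BCL_BC[OF inv_speed[of j]] unfolding BC_iff by blast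

lemma continuous_on_damping: "continuous_on strip (\<lambda>p. b p $ j $ j / a j p)"
proof -
  have "continuous_on strip (\<lambda>p. b p $ j $ j * (1 / a j p))"
    using coeff[of j j] unfolding BC_iff by (intro continuous_on_mult continuous_on_inv_speed) blast
  then show ?thesis by simp
qed

section \<open>The exponential factor along characteristics\<close>

lemma c_coef_pos: "0 < c_coef a b j \<xi> x t"
  by (simp add: c_coef_def)

lemma c_coef_self: "c_coef a b j x x t = 1"
  by (simp add: c_coef_def)

lemma DERIV_c_coef:
  assumes "x \<in> {0..1}" "\<xi> \<in> {0..1}"
  shows "((\<lambda>\<xi>. c_coef a b j \<xi> x t) has_real_derivative
    c_coef a b j \<xi> x t * (b (\<xi>, omega a j \<xi> x t) $ j $ j / a j (\<xi>, omega a j \<xi> x t))) (at \<xi> within {0..1})"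
  unfolding c_coef_def
  by (rule DERIV_chain'[OF DERIV_LBINT_unit[OF
        continuous_on_along_characteristic[OF continuous_on_damping assms(1)] assms] DERIV_exp])

lemma continuous_on_c_coef:
  "continuous_on ({0..1} \<times> strip) (\<lambda>(\<xi>, x, t). c_coef a b j \<xi> x t)"
proof -
  define f where "f = (\<lambda>(p :: real \<times> real \<times> real) s.
    b (s, omega a j s (fst (snd p)) (snd (snd p))) $ j $ j / a j (s, omega a j s (fst (snd p)) (snd (snd p))))"
  have "continuous_on (({0..1} \<times> strip) \<times> {0..1})
      (\<lambda>z. (\<lambda>(\<xi>, x, t). b (\<xi>, omega a j \<xi> x t) $ j $ j / a j (\<xi>, omega a j \<xi> x t)) (snd z, snd (fst z)))"
    by (rule continuous_on_compose2[OF continuous_on_along_characteristics[OF continuous_on_damping]])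
       (auto intro!: continuous_intros)
  then have "continuous_on (({0..1} \<times> strip) \<times> {0..1}) (\<lambda>(p, s). f p s)"
    by (simp add: case_prod_unfold f_def)
  then have "continuous_on ({0..1} \<times> strip) (\<lambda>p. LBINT s=ereal (fst (snd p))..ereal (fst p). f p s)"
    by (rule continuous_on_LBINT_unit) (auto intro!: continuous_intros simp: mem_strip)
  then have "continuous_on ({0..1} \<times> strip) (\<lambda>p. exp (LBINT s=ereal (fst (snd p))..ereal (fst p). f p s))"
    by (rule continuous_on_exp)
  then show ?thesis
    by (simp add: case_prod_unfold f_def c_coef_def)
qed

text \<open>By the flow property both exponents integrate the same function along one
  characteristic, so they add up.\<close>

lemma c_coef_flow:
  assumes "x \<in> {0..1}" "y \<in> {0..1}" "\<xi> \<in> {0..1}"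
  shows "c_coef a b j y x t * c_coef a b j \<xi> y (omega a j y x t) = c_coef a b j \<xi> x t"
proof -
  let ?f = "\<lambda>\<eta>. b (\<eta>, omega a j \<eta> x t) $ j $ j / a j (\<eta>, omega a j \<eta> x t)"
  have "c_coef a b j \<xi> y (omega a j y x t) = exp (LBINT \<eta>=ereal y..ereal \<xi>. ?f \<eta>)"
    unfolding c_coef_def by (rule arg_cong[where f = exp], rule LBINT_unit_cong) (use assms in \<open>simp_all add: omega_flow\<close>)
  moreover have "(LBINT \<eta>=ereal x..ereal y. ?f \<eta>) + (LBINT \<eta>=ereal y..ereal \<xi>. ?f \<eta>) = (LBINT \<eta>=ereal x..ereal \<xi>. ?f \<eta>)"
    by (rule LBINT_unit_combine[OF continuous_on_along_characteristic[OF continuous_on_damping]]) (use assms in auto)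
  ultimately show ?thesis
    unfolding c_coef_def by (simp add: exp_add[symmetric])
qed

text \<open>The right-hand side of the \<open>j\<close>-th integral equation, with starting point \<open>y\<close> in place of
  \<open>x\<^sub>j\<close> and with source term \<open>F\<close>.\<close>

definition duhamel :: "'n \<Rightarrow> real \<Rightarrow> (real \<times> real \<Rightarrow> real) \<Rightarrow> (real \<times> real \<Rightarrow> real) \<Rightarrow> real \<Rightarrow> real \<Rightarrow> real" where
  "duhamel j y w F x t = c_coef a b j y x t * w (1 - y, omega a j y x t)
     - (LBINT \<xi>=ereal y..ereal x. d_coef a b j \<xi> x t * F (\<xi>, omega a j \<xi> x t))"

lemma continuous_on_d_coef_source:
  assumes "continuous_on strip F"
  shows "continuous_on ({0..1} \<times> strip) (\<lambda>(\<xi>, x, t). d_coef a b j \<xi> x t * F (\<xi>, omega a j \<xi> x t))"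
proof -
  have "continuous_on ({0..1} \<times> strip) (\<lambda>z. (\<lambda>(\<xi>, x, t). c_coef a b j \<xi> x t) z *
      (\<lambda>(\<xi>, x, t). 1 / a j (\<xi>, omega a j \<xi> x t)) z * (\<lambda>(\<xi>, x, t). F (\<xi>, omega a j \<xi> x t)) z)"
    by (intro continuous_intros continuous_on_c_coef continuous_on_along_characteristics[OF assms]
        continuous_on_along_characteristics[OF continuous_on_inv_speed])
  then show ?thesis
    by (simp add: case_prod_unfold d_coef_def)
qed

lemma continuous_on_d_coef_source_section:
  assumes "continuous_on strip F" "x \<in> {0..1}"
  shows "continuous_on {0..1} (\<lambda>\<xi>. d_coef a b j \<xi> x t * F (\<xi>, omega a j \<xi> x t))"
proof -
  have "continuous_on {0..1} (\<lambda>\<xi>. (\<lambda>(\<xi>, x, t). d_coef a b j \<xi> x t * F (\<xi>, omega a j \<xi> x t)) (\<xi>, x, t))"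
    by (rule continuous_on_compose2[OF continuous_on_d_coef_source[OF assms(1)]])
       (use assms(2) in \<open>auto intro!: continuous_intros simp: mem_strip\<close>)
  then show ?thesis by simp
qed

lemma continuous_on_duhamel:
  assumes w: "continuous_on strip w" and F: "continuous_on strip F" and y: "y \<in> {0..1}"
  shows "continuous_on strip (\<lambda>(x, t). duhamel j y w F x t)"
proof -
  have pair: "continuous_on strip (\<lambda>p. (y, p))" "(\<lambda>p. (y, p)) ` strip \<subseteq> {0..1} \<times> strip"
    using y by (auto intro!: continuous_intros)
  have c: "continuous_on strip (\<lambda>p. (\<lambda>(\<xi>, x, t). c_coef a b j \<xi> x t) (y, p))"
    by (rule continuous_on_compose2[OF continuous_on_c_coef pair])
  have "continuous_on strip (\<lambda>p. (\<lambda>(\<xi>, x, t). omega a j \<xi> x t) (y, p))"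
    by (rule continuous_on_compose2[OF continuous_on_omega pair])
  then have "continuous_on strip (\<lambda>p. w (1 - y, (\<lambda>(\<xi>, x, t). omega a j \<xi> x t) (y, p)))"
    by (intro continuous_on_compose2[OF w]) (use y in \<open>auto intro!: continuous_intros simp: mem_strip\<close>)
  note 1 = continuous_on_mult[OF c this]
  define f where "f = (\<lambda>(p :: real \<times> real) \<xi>. d_coef a b j \<xi> (fst p) (snd p) * F (\<xi>, omega a j \<xi> (fst p) (snd p)))"
  have "continuous_on (strip \<times> {0..1})
      (\<lambda>z. (\<lambda>(\<xi>, x, t). d_coef a b j \<xi> x t * F (\<xi>, omega a j \<xi> x t)) (snd z, fst z))"
    by (rule continuous_on_compose2[OF continuous_on_d_coef_source[OF F]]) (auto intro!: continuous_intros)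
  then have "continuous_on (strip \<times> {0..1}) (\<lambda>(p, s). f p s)"
    by (simp add: case_prod_unfold f_def)
  then have "continuous_on strip (\<lambda>p. LBINT s=ereal y..ereal (fst p). f p s)"
    by (rule continuous_on_LBINT_unit) (use y in \<open>auto intro!: continuous_intros simp: mem_strip\<close>)
  with 1 show ?thesis
    by (simp add: case_prod_unfold f_def duhamel_def continuous_on_diff)
qed

lemma duhamel_diff:
  assumes "continuous_on strip F" "continuous_on strip G" "x \<in> {0..1}" "y \<in> {0..1}"
  shows "duhamel j y v F x t - duhamel j y w G x t = duhamel j y (\<lambda>p. v p - w p) (\<lambda>p. F p - G p) x t"
proof -
  note cF = continuous_on_d_coef_source_section[OF assms(1,3), of j t]
  note cG = continuous_on_d_coef_source_section[OF assms(2,3), of j t]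
  note cFG = continuous_on_d_coef_source_section[OF continuous_on_diff[OF assms(1,2)] assms(3), of j t]
  have "integral {0..z} (\<lambda>\<xi>. d_coef a b j \<xi> x t * (F (\<xi>, omega a j \<xi> x t) - G (\<xi>, omega a j \<xi> x t)))
      = integral {0..z} (\<lambda>\<xi>. d_coef a b j \<xi> x t * F (\<xi>, omega a j \<xi> x t))
        - integral {0..z} (\<lambda>\<xi>. d_coef a b j \<xi> x t * G (\<xi>, omega a j \<xi> x t))" if "z \<in> {0..1}" for z
    unfolding right_diff_distrib
    by (rule Henstock_Kurzweil_Integration.integral_diff; rule integrable_continuous_real;
        rule continuous_on_subset[OF cF] continuous_on_subset[OF cG]; use that in auto)
  then show ?thesis
    unfolding duhamel_def LBINT_unit_eq[OF cF assms(4,3)] LBINT_unit_eq[OF cG assms(4,3)]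
      LBINT_unit_eq[OF cFG assms(4,3)]
    using assms(3,4) by (simp add: algebra_simps)
qed

text \<open>A solution started at \<open>y\<close> is periodic in \<open>x\<close>, so following the characteristic to the opposite
  boundary line expresses its value at \<open>y\<close> through the one at \<open>1 - y\<close>.\<close>

lemma duhamel_switch:
  assumes F: "continuous_on strip F" and y: "y \<in> {0, 1}"
    and sol: "\<And>x t. x \<in> {0..1} \<Longrightarrow> w (x, t) = duhamel j y w F x t" and x: "x \<in> {0..1}"
  shows "w (x, t) = duhamel j (1 - y) w F x t"
proof -
  let ?y = "1 - y"
  let ?f = "\<lambda>\<xi>. d_coef a b j \<xi> x t * F (\<xi>, omega a j \<xi> x t)"
  define s where "s = omega a j ?y x t"
  have yy: "y \<in> {0..1}" "?y \<in> {0..1}"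
    using y by auto
  \<comment> \<open>On the starting line the exponential factor is 1 and the integral is empty, so
    the equation itself reads as the periodic boundary condition.\<close>
  have per: "w (y, s) = w (?y, s)"
    using sol[OF yy(1), of s] by (simp add: duhamel_def c_coef_self omega_spec(1)[OF yy(1)])
  have flow: "omega a j \<xi> ?y s = omega a j \<xi> x t" if "\<xi> \<in> {0..1}" for \<xi>
    unfolding s_def using omega_flow[OF x yy(2) that] .
  have c: "c_coef a b j ?y x t * c_coef a b j \<xi> ?y s = c_coef a b j \<xi> x t" if "\<xi> \<in> {0..1}" for \<xi>
    unfolding s_def using c_coef_flow[OF x yy(2) that] .
  have "c_coef a b j ?y x t * (LBINT \<xi>=ereal y..ereal ?y. d_coef a b j \<xi> ?y s * F (\<xi>, omega a j \<xi> ?y s))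
      = (LBINT \<xi>=ereal y..ereal ?y. c_coef a b j ?y x t * (d_coef a b j \<xi> ?y s * F (\<xi>, omega a j \<xi> ?y s)))"
    by simp
  also have "\<dots> = (LBINT \<xi>=ereal y..ereal ?y. ?f \<xi>)"
    by (rule LBINT_unit_cong[OF yy]) (simp add: d_coef_def flow c[symmetric])
  finally have int: "c_coef a b j ?y x t *
      (LBINT \<xi>=ereal y..ereal ?y. d_coef a b j \<xi> ?y s * F (\<xi>, omega a j \<xi> ?y s))
      = (LBINT \<xi>=ereal y..ereal ?y. ?f \<xi>)" .
  \<comment> \<open>The equation at the crossing point \<open>(1 - y, s)\<close> is multiplied by
    the factor from there to \<open>(x, t)\<close>. It reproduces the boundary term of the equation
    at \<open>(x, t)\<close> and the integral from \<open>y\<close> to \<open>1 - y\<close>; the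
    part from \<open>1 - y\<close> to \<open>x\<close> is what remains in the switched
    equation.\<close>
  have "c_coef a b j ?y x t * w (?y, s)
      = c_coef a b j y x t * w (?y, omega a j y x t) - (LBINT \<xi>=ereal y..ereal ?y. ?f \<xi>)"
    unfolding sol[OF yy(2), of s] duhamel_def right_diff_distrib int
    by (simp add: flow[OF yy(1)] c[OF yy(1), symmetric])
  moreover have "(LBINT \<xi>=ereal y..ereal ?y. ?f \<xi>) + (LBINT \<xi>=ereal ?y..ereal x. ?f \<xi>) = (LBINT \<xi>=ereal y..ereal x. ?f \<xi>)"
    by (rule LBINT_unit_combine[OF continuous_on_d_coef_source_section[OF F x] yy x])
  ultimately show ?thesis
    using sol[OF x, of t] per by (simp add: duhamel_def s_def[symmetric])
qed

text \<open>The weight is \<open>c_coef a b j y x t\<close>. The source bound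
  \<open>\<gamma> * R\<close> is at most \<open>R\<close> times the absolute damping coefficient, so
  the integrand is dominated by the derivative of \<open>R\<close> times the signed factor, and the
  integral by \<open>(1 - c) * R\<close>. At \<open>x = 1 - y\<close> the characteristic has crossed
  the whole strip, which gives the full damping \<open>exp (- \<gamma>)\<close>.\<close>

lemma duhamel_bound:
  assumes y: "y \<in> {0, 1}" and "\<gamma> > 0"
    and damp: "\<And>p. p \<in> strip \<Longrightarrow> \<gamma> \<le> (1 - 2 * y) * (b p $ j $ j / a j p)"
    and F: "continuous_on strip F" "\<And>p. p \<in> strip \<Longrightarrow> \<bar>F p / a j p\<bar> \<le> \<gamma> * R"
    and w: "\<And>t. \<bar>w (1 - y, t)\<bar> \<le> W" and x: "x \<in> {0..1}"
  obtains c where "0 < c" "c \<le> 1" "x = 1 - y \<Longrightarrow> c \<le> exp (- \<gamma>)"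
    "\<bar>duhamel j y w F x t\<bar> \<le> c * W + (1 - c) * R"
proof -
  let ?w = "\<lambda>\<xi>. omega a j \<xi> x t" and ?c = "\<lambda>\<xi>. c_coef a b j \<xi> x t"
  let ?p = "\<lambda>\<xi>. b (\<xi>, omega a j \<xi> x t) $ j $ j / a j (\<xi>, omega a j \<xi> x t)"
  let ?f = "\<lambda>\<xi>. d_coef a b j \<xi> x t * F (\<xi>, omega a j \<xi> x t)"
  \<comment> \<open>This is the sign of the damping coefficient: positive when starting on the left
    line, negative when starting on the right one.\<close>
  define \<sigma> where "\<sigma> = 1 - 2 * y"
  have \<sigma>: "\<sigma> = 1 \<and> y = 0 \<or> \<sigma> = - 1 \<and> y = 1"
    using y by (auto simp: \<sigma>_def)
  have yy: "y \<in> {0..1}"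
    using y by auto
  have p: "\<gamma> \<le> \<sigma> * ?p \<xi>" if "\<xi> \<in> {0..1}" for \<xi>
    unfolding \<sigma>_def using that by (intro damp) (auto simp: mem_strip)
  have "\<bar>F (x, t) / a j (x, t)\<bar> \<le> \<gamma> * R"
    using x by (intro F(2)) (simp add: mem_strip)
  then have "0 \<le> \<gamma> * R"
    using abs_ge_zero order_trans by blast
  then have R: "0 \<le> R"
    using \<open>\<gamma> > 0\<close> by (simp add: zero_le_mult_iff)
  \<comment> \<open>The exponent times \<open>\<sigma>\<close> grows at least as fast as the linear
    function of slope \<open>\<gamma>\<close>; comparing the increments between \<open>x\<close> and
    \<open>y\<close> gives the decay rate.\<close>
  have "(LBINT \<eta>=ereal x..ereal y. ?p \<eta>) \<le> - \<gamma> * \<bar>x - y\<bar>"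
  proof -
    let ?P = "\<lambda>\<xi>. LBINT \<eta>=ereal x..ereal \<xi>. ?p \<eta>"
    have "\<bar>\<gamma> * r' - \<gamma> * r\<bar> \<le> \<sigma> * ?P r' - \<sigma> * ?P r" if "r \<le> r'" "r \<in> {0..1}" "r' \<in> {0..1}" for r r'
    proof (rule abs_diff_le_of_deriv_dominated[OF that(1)])
      fix s assume "s \<in> {r..r'}"
      then have s: "s \<in> {0..1}" "{r..r'} \<subseteq> {0..1}"
        using that by auto
      show "((\<lambda>r. \<gamma> * r) has_real_derivative \<gamma>) (at s within {r..r'})"
        by (auto intro!: derivative_eq_intros)
      show "((\<lambda>r. \<sigma> * ?P r) has_real_derivative \<sigma> * ?p s) (at s within {r..r'})"
        by (rule DERIV_subset[OF DERIV_cmult[OF DERIV_LBINT_unit[OF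
              continuous_on_along_characteristic[OF continuous_on_damping x] x s(1)]] s(2)])
      show "\<bar>\<gamma>\<bar> \<le> \<sigma> * ?p s"
        using p[OF s(1)] \<open>\<gamma> > 0\<close> by simp
    qed
    from this[of y x] this[of x y] show ?thesis
      using \<sigma> x \<open>\<gamma> > 0\<close> by (auto simp: algebra_simps)
  qed
  then have c_le: "?c y \<le> exp (- \<gamma> * \<bar>x - y\<bar>)"
    by (simp add: c_coef_def)
  also have "\<dots> \<le> 1"
    using \<open>\<gamma> > 0\<close> by simp
  finally have c1: "?c y \<le> 1" .
  \<comment> \<open>The subtracted integral is zero; it presents the other one as an increment, to
    which the derivative comparison applies.\<close>
  have "\<bar>(LBINT \<xi>=ereal y..ereal x. ?f \<xi>) - (LBINT \<xi>=ereal y..ereal y. ?f \<xi>)\<bar>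
      \<le> \<bar>R * \<sigma> * ?c x - R * \<sigma> * ?c y\<bar>"
  proof (rule abs_diff_le_of_deriv_dominated_unit[OF x yy])
    fix s :: real assume s: "s \<in> {0..1}"
    show "((\<lambda>z. LBINT \<xi>=ereal y..ereal z. ?f \<xi>) has_real_derivative ?f s) (at s within {0..1})"
      by (rule DERIV_LBINT_unit[OF continuous_on_d_coef_source_section[OF F(1) x] yy s])
    show "((\<lambda>\<xi>. R * \<sigma> * ?c \<xi>) has_real_derivative R * \<sigma> * (?c s * ?p s)) (at s within {0..1})"
      by (rule DERIV_cmult[OF DERIV_c_coef[OF x s]])
    have "\<bar>?f s\<bar> = ?c s * \<bar>F (s, ?w s) / a j (s, ?w s)\<bar>"
      by (simp add: d_coef_def abs_mult c_coef_pos less_imp_le)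
    also have "\<dots> \<le> ?c s * (\<gamma> * R)"
      using s less_imp_le[OF c_coef_pos] by (intro mult_left_mono F(2)) (auto simp: mem_strip)
    also have "\<dots> \<le> ?c s * (\<sigma> * ?p s * R)"
      using p[OF s] R less_imp_le[OF c_coef_pos] by (intro mult_left_mono mult_right_mono) auto
    finally show "\<bar>?f s\<bar> \<le> R * \<sigma> * (?c s * ?p s)"
      by (simp add: mult_ac)
  qed
  also have "\<dots> = R * (1 - ?c y)"
  proof -
    have "R * \<sigma> * ?c x - R * \<sigma> * ?c y = R * \<sigma> * (1 - ?c y)"
      by (simp add: c_coef_self algebra_simps)
    then show ?thesis
      using \<sigma> c1 R by (auto simp: abs_mult)
  qed
  finally have int: "\<bar>LBINT \<xi>=ereal y..ereal x. ?f \<xi>\<bar> \<le> (1 - ?c y) * R"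
    by (simp add: mult.commute)
  have "\<bar>?c y * w (1 - y, ?w y)\<bar> \<le> ?c y * W"
    unfolding abs_mult using c_coef_pos[of j y x t] w by (simp add: mult_left_mono)
  with int have "\<bar>duhamel j y w F x t\<bar> \<le> ?c y * W + (1 - ?c y) * R"
    unfolding duhamel_def by linarith
  moreover have "x = 1 - y \<Longrightarrow> ?c y \<le> exp (- \<gamma>)"
    using c_le \<sigma> by auto
  ultimately show ?thesis
    using that c_coef_pos c1 by blast
qed

end

section \<open>The coupled system\<close>

text \<open>The starting point \<open>y j\<close> is chosen so that the solution of the \<open>j\<close>-th equation is damped
  along the characteristics that leave the line \<open>x = y j\<close>.\<close>

locale damped_transport = transport a b
  for a :: "'n::{finite, linorder} \<Rightarrow> real \<times> real \<Rightarrow> real" and b :: "'n mat_fun" +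
  fixes y :: "'n \<Rightarrow> real" and \<gamma> :: "'n \<Rightarrow> real" and \<gamma>0 \<kappa> :: real
  assumes y: "\<And>j. y j \<in> {0, 1}"
    and gamma0: "\<gamma>0 > 0" "\<And>j. \<gamma>0 \<le> \<gamma> j"
    and damping: "\<And>j p. p \<in> strip \<Longrightarrow> \<gamma> j \<le> (1 - 2 * y j) * (b p $ j $ j / a j p)"
    and kappa: "0 \<le> \<kappa>" "\<kappa> < 1"
    and coupling: "\<And>j p. p \<in> strip \<Longrightarrow> (\<Sum>k | k \<noteq> j. \<bar>b p $ j $ k / a j p\<bar>) \<le> \<kappa> * \<gamma> j"
begin

lemma y_unit: "y j \<in> {0..1}"
  using y[of j] by auto

lemma gamma_pos: "\<gamma> j > 0"
  using gamma0(1) gamma0(2)[of j] by linarith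

definition coupled_source :: "'n vec_fun \<Rightarrow> 'n vec_fun \<Rightarrow> 'n \<Rightarrow> real \<times> real \<Rightarrow> real" where
  "coupled_source h u j p = (\<Sum>k | k \<noteq> j. b p $ j $ k * u p $ k) - h p $ j"

definition duhamel_map :: "'n vec_fun \<Rightarrow> 'n vec_fun \<Rightarrow> 'n vec_fun" where
  "duhamel_map h u = (\<lambda>(x, t). \<chi> j. duhamel j (y j) (\<lambda>p. u p $ j) (coupled_source h u j) x t)"

section \<open>Bounds for the coupled integral operator\<close>

lemma continuous_on_component:
  fixes u :: "'n vec_fun"
  assumes "u \<in> BC"
  shows "continuous_on strip (\<lambda>p. u p $ k)"
  using assms unfolding BC_iff by (intro continuous_intros) auto

lemma continuous_on_coupled_source:
  assumes "h \<in> BC" "u \<in> BC"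
  shows "continuous_on strip (coupled_source h u j)"
proof -
  have "continuous_on strip (\<lambda>p. b p $ j $ k)" for k
    using coeff[of j k] unfolding BC_iff by blast
  then show ?thesis
    unfolding coupled_source_def[abs_def]
    using continuous_on_component[OF assms(1)] continuous_on_component[OF assms(2)]
    by (intro continuous_on_diff continuous_on_sum continuous_on_mult)
qed

text \<open>The factor \<open>\<gamma> j\<close> is split off because the source is measured
  relative to the damping rate in the estimate of one component; \<open>\<kappa> * Z + H\<close>
  then does not depend on \<open>j\<close>.\<close>

lemma coupled_source_bound:
  assumes p: "p \<in> strip" and u: "\<And>k. \<bar>u p $ k\<bar> \<le> Z" and h: "\<bar>h p $ j / a j p\<bar> \<le> \<gamma> j * H"
  shows "\<bar>coupled_source h u j p / a j p\<bar> \<le> \<gamma> j * (\<kappa> * Z + H)"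
proof -
  have Z: "0 \<le> Z"
    using u[of j] by linarith
  have "\<bar>\<Sum>k | k \<noteq> j. b p $ j $ k / a j p * u p $ k\<bar> \<le> (\<Sum>k | k \<noteq> j. \<bar>b p $ j $ k / a j p\<bar> * Z)"
    by (rule order_trans[OF sum_abs sum_mono])
       (simp only: abs_mult mult_left_mono[OF u abs_ge_zero])
  also have "\<dots> \<le> \<kappa> * \<gamma> j * Z"
    unfolding sum_distrib_right[symmetric] using coupling[OF p, of j] Z by (rule mult_right_mono)
  finally have "\<bar>(\<Sum>k | k \<noteq> j. b p $ j $ k / a j p * u p $ k) - h p $ j / a j p\<bar>
      \<le> \<kappa> * \<gamma> j * Z + \<gamma> j * H"
    using h by linarith
  moreover have "coupled_source h u j p / a j p
      = (\<Sum>k | k \<noteq> j. b p $ j $ k / a j p * u p $ k) - h p $ j / a j p"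
    by (simp add: coupled_source_def diff_divide_distrib sum_divide_distrib)
  ultimately show ?thesis
    by (simp add: algebra_simps)
qed

text \<open>\<open>Z\<close> enters through the coupling, while \<open>Zb\<close> bounds only
  component \<open>j\<close> on the line \<open>x = 1 - y j\<close> that supplies its boundary data.
  Keeping the two apart lets a gain on that line pass into the next application of the map.\<close>

lemma duhamel_map_bound:
  assumes hu: "h \<in> BC" "u \<in> BC"
    and Z: "\<And>p k. p \<in> strip \<Longrightarrow> \<bar>u p $ k\<bar> \<le> Z"
    and h: "\<And>p j. p \<in> strip \<Longrightarrow> \<bar>h p $ j / a j p\<bar> \<le> \<gamma> j * H"
    and Zb: "\<And>t. \<bar>u (1 - y j, t) $ j\<bar> \<le> Zb" and x: "x \<in> {0..1}"
  obtains c where "0 < c" "c \<le> 1" "x = 1 - y j \<Longrightarrow> c \<le> exp (- \<gamma>0)"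
    "\<bar>duhamel_map h u (x, t) $ j\<bar> \<le> c * Zb + (1 - c) * (\<kappa> * Z + H)"
proof -
  have src: "\<bar>coupled_source h u j p / a j p\<bar> \<le> \<gamma> j * (\<kappa> * Z + H)" if "p \<in> strip" for p
    using that by (intro coupled_source_bound Z h)
  obtain c where c: "0 < c" "c \<le> 1" "x = 1 - y j \<Longrightarrow> c \<le> exp (- \<gamma> j)"
      "\<bar>duhamel j (y j) (\<lambda>p. u p $ j) (coupled_source h u j) x t\<bar> \<le> c * Zb + (1 - c) * (\<kappa> * Z + H)"
    using duhamel_bound[where w = "\<lambda>p. u p $ j" and t = t,
        OF y gamma_pos damping continuous_on_coupled_source[OF hu] src Zb x]
    by metis
  have "exp (- \<gamma> j) \<le> exp (- \<gamma>0)"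
    using gamma0(2) by simp
  then have "x = 1 - y j \<Longrightarrow> c \<le> exp (- \<gamma>0)"
    using c(3) by linarith
  then show ?thesis
    using c by (intro that[of c]) (simp_all add: duhamel_map_def)
qed

lemma BC_duhamel_map:
  assumes hu: "h \<in> BC" "u \<in> BC" and h: "\<And>p j. p \<in> strip \<Longrightarrow> \<bar>h p $ j / a j p\<bar> \<le> \<gamma> j * H"
  shows "duhamel_map h u \<in> BC"
  unfolding BC_vec_iff
proof
  fix j
  obtain Z where Z: "Z > 0" "\<And>p k. p \<in> strip \<Longrightarrow> \<bar>u p $ k\<bar> \<le> Z"
    using BC_component_bound[OF hu(2)] by metis
  have "\<bar>h (0, 0) $ j / a j (0, 0)\<bar> \<le> \<gamma> j * H"
    by (rule h) (simp add: mem_strip)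
  then have "0 \<le> \<gamma> j * H"
    using abs_ge_zero order_trans by blast
  then have H: "0 \<le> H"
    using gamma_pos[of j] by (simp add: zero_le_mult_iff)
  have "norm (duhamel_map h u p $ j) \<le> Z + (\<kappa> * Z + H)" if "p \<in> strip" for p
  proof -
    obtain x t where p: "p = (x, t)" and x: "x \<in> {0..1}"
      using \<open>p \<in> strip\<close> mem_strip by (cases p) auto
    have "\<bar>u (1 - y j, t) $ j\<bar> \<le> Z" for t
      using y_unit[of j] by (intro Z) (simp add: mem_strip)
    then obtain c where c: "0 < c" "c \<le> 1"
        "\<bar>duhamel_map h u (x, t) $ j\<bar> \<le> c * Z + (1 - c) * (\<kappa> * Z + H)"
      using duhamel_map_bound[OF hu Z(2) h _ x, of j Z t] by metis
    have "c * Z + (1 - c) * (\<kappa> * Z + H) \<le> Z + (\<kappa> * Z + H)"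
      using c Z H kappa by (intro add_mono mult_left_le_one_le) auto
    then show ?thesis
      using c(3) p by simp
  qed
  moreover have "continuous_on strip (\<lambda>p. duhamel_map h u p $ j)"
    using continuous_on_duhamel[OF continuous_on_component[OF hu(2)]
        continuous_on_coupled_source[OF hu] y_unit, of j j j]
    by (simp add: duhamel_map_def case_prod_unfold)
  ultimately show "(\<lambda>p. duhamel_map h u p $ j) \<in> BC"
    unfolding BC_iff by blast
qed

text \<open>The map is affine in \<open>u\<close>; in a difference the inhomogeneity cancels and the
  homogeneous map remains.\<close>

lemma duhamel_map_diff:
  assumes "h \<in> BC" "u \<in> BC" "w \<in> BC" "p \<in> strip"
  shows "duhamel_map h u p - duhamel_map h w p = duhamel_map (\<lambda>_. 0) (\<lambda>p. u p - w p) p"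
proof -
  have "coupled_source h u j p - coupled_source h w j p = coupled_source (\<lambda>_. 0) (\<lambda>p. u p - w p) j p" for j p
    by (simp add: coupled_source_def sum_subtractf[symmetric] algebra_simps)
  then have src: "(\<lambda>p. coupled_source h u j p - coupled_source h w j p) = coupled_source (\<lambda>_. 0) (\<lambda>p. u p - w p) j" for j
    by auto
  obtain x t where p: "p = (x, t)" and x: "x \<in> {0..1}"
    using \<open>p \<in> strip\<close> mem_strip by (cases p) auto
  show ?thesis
    unfolding p vec_eq_iff duhamel_map_def
    using duhamel_diff[OF continuous_on_coupled_source[OF assms(1,2)]
        continuous_on_coupled_source[OF assms(1,3)] x y_unit]
    by (simp add: src)
qed

text \<open>The convex combination of \<open>1\<close> and \<open>\<kappa>\<close> with the largest
  weight on \<open>1\<close> that is possible on the line \<open>x = 1 - y j\<close>. It is the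
  contraction factor of two applications of the map.\<close>

definition \<rho> :: real where
  "\<rho> = exp (- \<gamma>0) + (1 - exp (- \<gamma>0)) * \<kappa>"

lemma exp_gamma0: "0 < exp (- \<gamma>0)" "exp (- \<gamma>0) < 1"
  using gamma0 by auto

lemma rho: "0 \<le> \<rho>" "\<rho> < 1" "\<kappa> \<le> \<rho>"
proof -
  show "0 \<le> \<rho>"
    unfolding \<rho>_def using exp_gamma0 kappa by (intro add_nonneg_nonneg mult_nonneg_nonneg) auto
  have "(1 - exp (- \<gamma>0)) * \<kappa> < (1 - exp (- \<gamma>0)) * 1"
    using exp_gamma0 kappa by (intro mult_strict_left_mono) auto
  then show "\<rho> < 1"
    unfolding \<rho>_def by simp
  have "0 \<le> exp (- \<gamma>0) * (1 - \<kappa>)"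
    using kappa by simp
  then show "\<kappa> \<le> \<rho>"
    unfolding \<rho>_def by (simp add: algebra_simps)
qed

text \<open>One step contracts only on the line \<open>x = 1 - y j\<close>. The second step starts
  from that line, hence two steps contract everywhere.\<close>

lemma duhamel_map_twice_bound:
  assumes hu: "h \<in> BC" "u \<in> BC"
    and h: "\<And>p j. p \<in> strip \<Longrightarrow> \<bar>h p $ j / a j p\<bar> \<le> \<gamma> j * H"
    and Z: "\<And>p k. p \<in> strip \<Longrightarrow> \<bar>u p $ k\<bar> \<le> Z"
    and Z': "\<And>p k. p \<in> strip \<Longrightarrow> \<bar>duhamel_map h u p $ k\<bar> \<le> Z" and ZH: "\<kappa> * Z + H \<le> Z" and "0 \<le> H"
    and p: "p \<in> strip"
  shows "\<bar>duhamel_map h (duhamel_map h u) p $ j\<bar> \<le> \<rho> * Z + H"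
proof -
  let ?R = "\<kappa> * Z + H" and ?e = "exp (- \<gamma>0)"
  obtain x t where x: "p = (x, t)" "x \<in> {0..1}"
    using p mem_strip by (cases p) auto
  have R: "?R \<le> \<rho> * Z + H"
  proof -
    have "\<bar>u p $ j\<bar> \<le> Z" using Z[OF p] .
    then have "\<kappa> * Z \<le> \<rho> * Z"
      by (intro mult_right_mono rho) linarith
    then show ?thesis by simp
  qed
  have "\<bar>duhamel_map h u (1 - y j, t) $ j\<bar> \<le> \<rho> * Z + H" for t
  proof -
    have y': "1 - y j \<in> {0..1}"
      using y_unit[of j] by simp
    then have "\<bar>u (1 - y j, t) $ j\<bar> \<le> Z" for t
      by (intro Z) (simp add: mem_strip)
    then obtain c where c: "0 < c" "c \<le> ?e"
        "\<bar>duhamel_map h u (1 - y j, t) $ j\<bar> \<le> c * Z + (1 - c) * ?R"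
      using duhamel_map_bound[OF hu Z h _ y', of j Z t] by metis
    \<comment> \<open>Because \<open>?R \<le> Z\<close>, the convex combination increases with its
      weight \<open>c\<close>, which may therefore be replaced by its upper bound.\<close>
    have "c * (Z - ?R) \<le> ?e * (Z - ?R)"
      using c ZH by (intro mult_right_mono) auto
    then have "c * Z + (1 - c) * ?R \<le> ?e * Z + (1 - ?e) * ?R"
      by (simp add: algebra_simps)
    also have "\<dots> = \<rho> * Z + (1 - ?e) * H"
      by (simp add: \<rho>_def algebra_simps)
    also have "\<dots> \<le> \<rho> * Z + H"
      using exp_gamma0 \<open>0 \<le> H\<close> by (intro add_left_mono mult_left_le_one_le) auto
    finally show ?thesis
      using c(3) by linarith
  qed
  then obtain c where c: "0 < c" "c \<le> 1"
      "\<bar>duhamel_map h (duhamel_map h u) (x, t) $ j\<bar> \<le> c * (\<rho> * Z + H) + (1 - c) * ?R"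
    using duhamel_map_bound[OF hu(1) BC_duhamel_map[OF hu h] Z' h _ x(2), of j "\<rho> * Z + H" t] by metis
  \<comment> \<open>Now both the boundary value and \<open>?R\<close> are at most
    \<open>\<rho> * Z + H\<close>, so the bound holds for every weight between 0 and 1.\<close>
  have "(1 - c) * ?R \<le> (1 - c) * (\<rho> * Z + H)"
    using R c by (intro mult_left_mono) auto
  then show ?thesis
    using c(3) x(1) by (simp add: algebra_simps)
qed

section \<open>Fixed points: a priori bound and existence\<close>

lemma duhamel_map_cong:
  assumes "\<And>p. p \<in> strip \<Longrightarrow> u p = w p" "p \<in> strip"
  shows "duhamel_map h u p = duhamel_map h w p"
proof -
  obtain x t where p: "p = (x, t)" and x: "x \<in> {0..1}"
    using \<open>p \<in> strip\<close> mem_strip by (cases p) auto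
  have "duhamel j (y j) (\<lambda>p. u p $ j) (coupled_source h u j) x t
      = duhamel j (y j) (\<lambda>p. w p $ j) (coupled_source h w j) x t" for j
  proof -
    \<comment> \<open>The map reads its argument only on one boundary line and along characteristics
      over \<open>{0..1}\<close>, hence only on the strip.\<close>
    have "u (1 - y j, s) = w (1 - y j, s)" for s
      using y_unit[of j] by (intro assms(1)) (simp add: mem_strip)
    moreover have "(LBINT \<xi>=ereal (y j)..ereal x. d_coef a b j \<xi> x t * coupled_source h u j (\<xi>, omega a j \<xi> x t))
        = (LBINT \<xi>=ereal (y j)..ereal x. d_coef a b j \<xi> x t * coupled_source h w j (\<xi>, omega a j \<xi> x t))"
      by (rule LBINT_unit_cong[OF y_unit x])
         (use assms(1) in \<open>simp add: coupled_source_def mem_strip\<close>)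
    ultimately show ?thesis
      unfolding duhamel_def by simp
  qed
  then show ?thesis
    unfolding p duhamel_map_def by simp
qed

text \<open>A fixed point equals its image under two applications. With \<open>N\<close> the finite
  supremum of its components, the two-step bound gives \<open>N \<le> \<rho> * N + H\<close>, which
  is solved for \<open>N\<close>.\<close>

lemma duhamel_map_fixpoint_bound:
  assumes hu: "h \<in> BC" "u \<in> BC"
    and h: "\<And>p j. p \<in> strip \<Longrightarrow> \<bar>h p $ j / a j p\<bar> \<le> \<gamma> j * H" and H: "0 \<le> H"
    and fixed: "\<And>p. p \<in> strip \<Longrightarrow> duhamel_map h u p = u p"
    and p: "p \<in> strip"
  shows "\<bar>u p $ j\<bar> \<le> H / (1 - \<rho>)"
proof -
  let ?A = "(\<lambda>(p, k). \<bar>u p $ k\<bar>) ` (strip \<times> UNIV)"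
  define N where "N = Sup ?A"
  obtain M where M: "\<And>p k. p \<in> strip \<Longrightarrow> \<bar>u p $ k\<bar> \<le> M"
    using BC_component_bound[OF hu(2)] by metis
  have bdd: "bdd_above ?A"
    by (rule bdd_aboveI[of _ M]) (use M in auto)
  have N: "\<bar>u p $ k\<bar> \<le> N" if "p \<in> strip" for p k
    unfolding N_def by (rule cSup_upper[OF _ bdd]) (use that in force)
  have N_nonneg: "0 \<le> N"
    using N[OF p, of j] by linarith
  have "N \<le> \<rho> * N + H"
  \<comment> \<open>The two-step bound presupposes this inequality. If it fails, then
    \<open>N < \<kappa> * N + H\<close>, and \<open>\<kappa> \<le> \<rho>\<close> gives the claim
    directly.\<close>
  proof (cases "\<kappa> * N + H \<le> N")
    case False
    then show ?thesis
      using mult_right_mono[OF rho(3) N_nonneg] by linarith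
  next
    case True
    have "\<bar>u p $ k\<bar> \<le> \<rho> * N + H" if "p \<in> strip" for p k
    proof -
      have "duhamel_map h (duhamel_map h u) p = u p"
        using duhamel_map_cong[OF fixed that] fixed[OF that] by simp
      moreover have "\<bar>duhamel_map h u p $ k\<bar> \<le> N" if "p \<in> strip" for p k
        using N fixed that by simp
      then have "\<bar>duhamel_map h (duhamel_map h u) p $ k\<bar> \<le> \<rho> * N + H"
        using duhamel_map_twice_bound[OF hu h N _ True H that] by blast
      ultimately show ?thesis
        by simp
    qed
    then show ?thesis
      unfolding N_def by (intro cSup_least) (use p in auto)
  qed
  then have "N * (1 - \<rho>) \<le> H"
    by (simp add: algebra_simps)
  then have "N \<le> H / (1 - \<rho>)"
    using rho(2) by (simp add: pos_le_divide_eq)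
  then show ?thesis
    using N[OF p, of j] by linarith
qed

text \<open>Two applications contract the largest component by \<open>\<rho>\<close>. The complete
  space at hand carries the Euclidean norm on values, so enough pairs of applications are taken to
  outweigh the comparison of the two norms.\<close>

lemma duhamel_map_fixpoint_exists:
  assumes h: "h \<in> BC" and hb: "\<And>p j. p \<in> strip \<Longrightarrow> \<bar>h p $ j / a j p\<bar> \<le> \<gamma> j * H"
  obtains u where "u \<in> BC" "\<And>p. p \<in> strip \<Longrightarrow> duhamel_map h u p = u p"
proof -
  \<comment> \<open>This retraction of the plane onto the strip turns the map into one on bounded
    continuous functions on the whole plane.\<close>
  define cl :: "real \<times> real \<Rightarrow> real \<times> real" where "cl = (\<lambda>(x, t). (max 0 (min 1 x), t))"
  have cl: "cl p \<in> strip" "p \<in> strip \<Longrightarrow> cl p = p" for p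
    by (auto simp: cl_def strip_def case_prod_unfold)
  define P where "P U = Bcontfun (\<lambda>p. duhamel_map h (apply_bcontfun U) (cl p))"
    for U :: "(real \<times> real) \<Rightarrow>\<^sub>C ((real, 'n) vec)"
  have BC: "apply_bcontfun U \<in> BC" for U :: "(real \<times> real) \<Rightarrow>\<^sub>C ((real, 'n) vec)"
    unfolding BC_iff using norm_bounded[of U] by (intro conjI exI[of _ "norm U"]) auto
  have P: "apply_bcontfun (P U) p = duhamel_map h (apply_bcontfun U) (cl p)" for U p
  proof -
    have D: "duhamel_map h (apply_bcontfun U) \<in> BC"
      by (rule BC_duhamel_map[OF h BC hb])
    then have "continuous_on strip (duhamel_map h (apply_bcontfun U))"
      unfolding BC_iff by blast
    then have "continuous_on UNIV (\<lambda>p. duhamel_map h (apply_bcontfun U) (cl p))"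
      by (rule continuous_on_compose2)
         (use cl in \<open>auto simp: cl_def case_prod_unfold intro!: continuous_intros\<close>)
    moreover obtain M where "\<And>p. p \<in> strip \<Longrightarrow> norm (duhamel_map h (apply_bcontfun U) p) \<le> M"
      using D unfolding BC_iff by auto
    ultimately have "(\<lambda>p. duhamel_map h (apply_bcontfun U) (cl p)) \<in> bcontfun"
      by (rule bcontfun_normI) (use cl in auto)
    then show ?thesis
      unfolding P_def by (simp add: Bcontfun_inverse)
  qed
  have zero: "(\<lambda>_. 0) \<in> BC" "\<bar>(0 :: (real, 'n) vec) $ j / a j p\<bar> \<le> \<gamma> j * 0" for p j
    by (auto intro: BC_const)
  have BC_diff: "(\<lambda>p. apply_bcontfun U p - apply_bcontfun W p) \<in> BC"
    for U W :: "(real \<times> real) \<Rightarrow>\<^sub>C ((real, 'n) vec)"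
    using BC[of "U - W"] by (simp add: minus_bcontfun.rep_eq)
  \<comment> \<open>Stated for an arbitrary componentwise bound \<open>Z\<close> instead of a
    distance, the estimate can be iterated without losing a dimensional constant each time.\<close>
  have step: "\<bar>apply_bcontfun (P (P U)) p $ j - apply_bcontfun (P (P W)) p $ j\<bar> \<le> \<rho> * Z"
    if Z: "\<And>p j. \<bar>apply_bcontfun U p $ j - apply_bcontfun W p $ j\<bar> \<le> Z" for U W Z p j
  proof -
    define z where "z = (\<lambda>p. apply_bcontfun U p - apply_bcontfun W p)"
    have z: "z \<in> BC" "\<bar>z p $ k\<bar> \<le> Z" for p k
      using BC_diff Z by (auto simp: z_def)
    have Z0: "0 \<le> Z"
      using Z[of p j] by linarith
    then have kZ: "\<kappa> * Z \<le> Z"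
      using kappa by (simp add: mult_left_le_one_le)
    have PUW: "apply_bcontfun (P U) p - apply_bcontfun (P W) p = duhamel_map (\<lambda>_. 0) z p"
      if "p \<in> strip" for p
      using duhamel_map_diff[where u = "apply_bcontfun U" and w = "apply_bcontfun W", OF h BC BC that] by (simp add: P cl that z_def)
    have PPUW: "apply_bcontfun (P (P U)) p - apply_bcontfun (P (P W)) p
        = duhamel_map (\<lambda>_. 0) (duhamel_map (\<lambda>_. 0) z) (cl p)"
    proof -
      have "apply_bcontfun (P (P U)) p - apply_bcontfun (P (P W)) p
          = duhamel_map (\<lambda>_. 0) (\<lambda>p. apply_bcontfun (P U) p - apply_bcontfun (P W) p) (cl p)"
        using duhamel_map_diff[where u = "apply_bcontfun (P U)" and w = "apply_bcontfun (P W)",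
            OF h BC BC cl(1)[of p]] by (simp add: P[of "P _"])
      also have "\<dots> = duhamel_map (\<lambda>_. 0) (duhamel_map (\<lambda>_. 0) z) (cl p)"
        by (rule duhamel_map_cong[OF PUW cl(1)])
      finally show ?thesis .
    qed
    have "\<bar>duhamel_map (\<lambda>_. 0) z p $ k\<bar> \<le> Z" if p: "p \<in> strip" for p k
    proof -
      obtain x t where x: "p = (x, t)" "x \<in> {0..1}"
        using p mem_strip by (cases p) auto
      obtain c where c: "0 < c" "c \<le> 1"
          "\<bar>duhamel_map (\<lambda>_. 0) z (x, t) $ k\<bar> \<le> c * Z + (1 - c) * (\<kappa> * Z + 0)"
        using duhamel_map_bound[OF zero(1) z(1) z(2) zero(2) z(2) x(2), of k t] by metis
      have "(1 - c) * (\<kappa> * Z) \<le> (1 - c) * Z"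
        using c kZ by (intro mult_left_mono) auto
      then show ?thesis
        using c(3) x(1) by (simp add: algebra_simps)
    qed
    then have "\<bar>duhamel_map (\<lambda>_. 0) (duhamel_map (\<lambda>_. 0) z) (cl p) $ j\<bar> \<le> \<rho> * Z + 0"
      using kZ by (intro duhamel_map_twice_bound[OF zero(1) z(1) zero(2) z(2)] cl) auto
    then show ?thesis
      unfolding PPUW[symmetric] by simp
  qed
  have pow: "\<bar>apply_bcontfun ((P ^^ (2 * k)) U) p $ j - apply_bcontfun ((P ^^ (2 * k)) W) p $ j\<bar>
      \<le> \<rho> ^ k * dist U W" for U W p j k
  proof (induction k arbitrary: p j)
    case 0
    have "\<bar>(apply_bcontfun U p - apply_bcontfun W p) $ j\<bar> \<le> norm (apply_bcontfun U p - apply_bcontfun W p)"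
      by (rule component_le_norm_cart)
    also have "\<dots> \<le> dist U W"
      using dist_bounded[of U p W] by (simp add: dist_norm)
    finally show ?case by simp
  next
    case (Suc k)
    show ?case
      using step[OF Suc] by (simp add: mult.assoc)
  qed
  \<comment> \<open>The Euclidean norm is at most the sum of the component moduli; the resulting
    factor \<open>CARD('n)\<close> appears once and is absorbed by a large power of
    \<open>\<rho>\<close>.\<close>
  have "(\<lambda>k. real CARD('n) * \<rho> ^ k) \<longlonglongrightarrow> real CARD('n) * 0"
    using rho by (intro tendsto_mult_left LIMSEQ_realpow_zero)
  then have "eventually (\<lambda>k. real CARD('n) * \<rho> ^ k < 1) sequentially"
    by (rule order_tendstoD) simp
  then obtain k where k: "real CARD('n) * \<rho> ^ k < 1"
    by (auto simp: eventually_sequentially)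
  have "\<exists>U. P U = U"
  proof (rule fixpoint_of_power_contraction[OF _ k])
    fix U W
    show "dist ((P ^^ (2 * k)) U) ((P ^^ (2 * k)) W) \<le> real CARD('n) * \<rho> ^ k * dist U W"
    proof (rule dist_bound)
      fix p
      let ?z = "apply_bcontfun ((P ^^ (2 * k)) U) p - apply_bcontfun ((P ^^ (2 * k)) W) p"
      have "norm ?z \<le> (\<Sum>j\<in>UNIV. \<bar>?z $ j\<bar>)"
        by (rule norm_le_l1_cart)
      also have "\<dots> \<le> (\<Sum>j\<in>(UNIV::'n set). \<rho> ^ k * dist U W)"
        by (rule sum_mono) (use pow in simp)
      finally show "dist (apply_bcontfun ((P ^^ (2 * k)) U) p) (apply_bcontfun ((P ^^ (2 * k)) W) p)
          \<le> real CARD('n) * \<rho> ^ k * dist U W"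
        by (simp add: dist_norm)
    qed
  qed (use rho in simp)
  then obtain U where U: "P U = U" ..
  show ?thesis
  proof (rule that[OF BC])
    show "duhamel_map h (apply_bcontfun U) p = apply_bcontfun U p" if "p \<in> strip" for p
      using P[of U p] U cl(2)[OF that] by simp
  qed
qed

end

section \<open>Independence of the starting lines, and uniqueness\<close>

context damped_transport begin

text \<open>For given \<open>u\<close> the source of each equation is a fixed function, so every
  component can be moved to the opposite starting line separately. The passage works in both
  directions, whence the equivalence.\<close>

lemma duhamel_system_iff_fixpoint:
  assumes "h \<in> BC" "u \<in> BC" and s: "\<And>j. s j \<in> {0, 1}"
  shows "(\<forall>j. \<forall>(x, t)\<in>strip. u (x, t) $ j = duhamel j (s j) (\<lambda>p. u p $ j) (coupled_source h u j) x t)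
    \<longleftrightarrow> (\<forall>p\<in>strip. duhamel_map h u p = u p)"
proof -
  let ?Sol = "\<lambda>j r. \<forall>(x, t)\<in>strip. u (x, t) $ j = duhamel j r (\<lambda>p. u p $ j) (coupled_source h u j) x t"
  have switch: "?Sol j r'" if sol: "?Sol j r" and r: "r \<in> {0, 1}" "r' \<in> {0, 1}" for j r r'
  proof (cases "r' = r")
    case True
    then show ?thesis
      using sol by simp
  next
    case False
    then have r': "r' = 1 - r"
      using r by auto
    show ?thesis
    proof clarify
      fix x t assume "(x, t) \<in> strip"
      then have x: "x \<in> {0..1}"
        by (simp add: mem_strip)
      show "u (x, t) $ j = duhamel j r' (\<lambda>p. u p $ j) (coupled_source h u j) x t"
        unfolding r'
      proof (rule duhamel_switch[where w = "\<lambda>p. u p $ j",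
            OF continuous_on_coupled_source[OF assms(1,2)] r(1) _ x])
        fix x t :: real assume "x \<in> {0..1}"
        then have "(x, t) \<in> strip"
          by (simp add: mem_strip)
        then show "u (x, t) $ j = duhamel j r (\<lambda>p. u p $ j) (coupled_source h u j) x t"
          using sol by blast
      qed
    qed
  qed
  have "(\<forall>j. ?Sol j (s j)) \<longleftrightarrow> (\<forall>j. ?Sol j (y j))"
    using switch[OF _ s y] switch[OF _ y s] by blast
  also have "\<dots> \<longleftrightarrow> (\<forall>p\<in>strip. duhamel_map h u p = u p)"
  proof -
    have "(duhamel_map h u (x, t) = u (x, t))
      \<longleftrightarrow> (\<forall>j. u (x, t) $ j = duhamel j (y j) (\<lambda>p. u p $ j) (coupled_source h u j) x t)" for x t
      unfolding duhamel_map_def vec_eq_iff by (simp add: eq_commute)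
    then show ?thesis
      by fast
  qed
  finally show ?thesis .
qed

text \<open>The difference of two fixed points is a fixed point of the homogeneous map, and the a
  priori bound with \<open>H = 0\<close> makes it vanish.\<close>

lemma duhamel_map_fixpoint_unique:
  assumes h: "h \<in> BC" and u: "u \<in> BC" "\<And>p. p \<in> strip \<Longrightarrow> duhamel_map h u p = u p"
    and w: "w \<in> BC" "\<And>p. p \<in> strip \<Longrightarrow> duhamel_map h w p = w p" and p: "p \<in> strip"
  shows "u p = w p"
proof -
  have "(\<lambda>p. u p - w p) \<in> BC"
  proof -
    have "(\<lambda>p. u p $ j + (- 1) * w p $ j) \<in> BC" for j
      using u(1) w(1) unfolding BC_vec_iff by (intro BC_add BC_mult BC_const) auto
    then show ?thesis
      by (simp add: BC_vec_iff)
  qed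
  moreover have "duhamel_map (\<lambda>_. 0) (\<lambda>p. u p - w p) p = u p - w p" if "p \<in> strip" for p
    using duhamel_map_diff[OF h u(1) w(1) that] u(2) w(2) that by simp
  ultimately have "\<bar>(u p - w p) $ j\<bar> \<le> 0 / (1 - \<rho>)" for j
    using p by (intro duhamel_map_fixpoint_bound[where h = "\<lambda>_. 0" and H = 0 and u = "\<lambda>p. u p - w p"])
      (auto intro: BC_const)
  then show ?thesis
    by (simp add: vec_eq_iff)
qed

end

section \<open>The periodic problem\<close>

lemma abs_le_bc_norm:
  assumes "g \<in> BC" "p \<in> strip"
  shows "\<bar>g p $ j\<bar> \<le> bc_norm g"
proof -
  obtain M where "\<And>p j. p \<in> strip \<Longrightarrow> \<bar>g p $ j\<bar> \<le> M"
    using BC_component_bound[OF assms(1)] by metis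
  then have "bdd_above ((\<lambda>(p, j). \<bar>g p $ j\<bar>) ` (strip \<times> UNIV))"
    by (intro bdd_aboveI[of _ M]) auto
  then have "(\<lambda>(p, j). \<bar>g p $ j\<bar>) (p, j) \<le> bc_norm g"
    unfolding bc_norm_def using assms(2) by (intro cSUP_upper) auto
  then show ?thesis by simp
qed

lemma strip_nonempty: "strip \<noteq> {}"
  by (simp add: strip_def)

lemma bc_norm_le: "(\<And>p j. p \<in> strip \<Longrightarrow> \<bar>v p $ j\<bar> \<le> C) \<Longrightarrow> bc_norm v \<le> C"
  unfolding bc_norm_def using strip_nonempty by (intro cSUP_least) auto

lemma abs_matrix_vector_mult_le:
  fixes A :: "real ^ 'n ^ 'm"
  assumes "\<And>i k. \<bar>A $ i $ k\<bar> \<le> M" "\<And>k. \<bar>u $ k\<bar> \<le> N"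
  shows "\<bar>(A *v u) $ i\<bar> \<le> real CARD('n) * M * N"
proof -
  have "\<bar>(A *v u) $ i\<bar> \<le> (\<Sum>k\<in>UNIV. \<bar>A $ i $ k * u $ k\<bar>)"
    by (simp add: matrix_vector_mult_def)
  also have "\<dots> \<le> (\<Sum>k\<in>(UNIV :: 'n set). M * N)"
  proof (rule sum_mono)
    fix k
    show "\<bar>A $ i $ k * u $ k\<bar> \<le> M * N"
      unfolding abs_mult using assms(1)[of i k] assms(2)[of k] by (intro mult_mono) auto
  qed
  finally show ?thesis
    by (simp add: mult.assoc)
qed

section \<open>Pointwise bounds and regularity from the assumptions\<close>

lemma assumptions_L_bounds:
  assumes "assumptions_L astar bstar q a m"
  obtains l where "l > 0" "\<And>p. p \<in> strip \<Longrightarrow> l \<le> \<bar>det (q p)\<bar>" "\<And>p j. p \<in> strip \<Longrightarrow> l \<le> \<bar>a j p\<bar>"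
proof -
  obtain l where l: "l > 0"
    and pos: "\<And>j. upto_m m j \<Longrightarrow> l < (INF p\<in>strip. a j p)"
    and neg: "\<And>j. \<not> upto_m m j \<Longrightarrow> (SUP p\<in>strip. a j p) < - l"
    and det: "l < (INF p\<in>strip. \<bar>det (q p)\<bar>)"
    using assms unfolding assumptions_L_def by blast
  \<comment> \<open>A real infimum or supremum bounds the values only if the set is bounded on that
    side; the strict sign of the speeds supplies the bound 0.\<close>
  have sign: "if upto_m m j then 0 < a j p else a j p < 0" if "p \<in> strip" for p j
    using assms that unfolding assumptions_L_def by blast
  show ?thesis
  proof (rule that[OF l])
    fix p assume p: "p \<in> strip"
    have "(INF p\<in>strip. \<bar>det (q p)\<bar>) \<le> \<bar>det (q p)\<bar>"
      using p by (intro cINF_lower bdd_belowI[of _ 0]) auto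
    then show "l \<le> \<bar>det (q p)\<bar>"
      using det by linarith
    fix j
    show "l \<le> \<bar>a j p\<bar>"
    proof (cases "upto_m m j")
      case True
      have "(INF p\<in>strip. a j p) \<le> a j p"
        using p sign[of _ j] True by (intro cINF_lower bdd_belowI[of _ 0]) (auto intro: less_imp_le)
      then show ?thesis
        using pos[OF True] by linarith
    next
      case False
      have "a j p \<le> (SUP p\<in>strip. a j p)"
        using p sign[of _ j] False by (intro cSUP_upper bdd_aboveI[of _ 0]) (auto intro: less_imp_le)
      then show ?thesis
        using neg[OF False] by linarith
    qed
  qed
qed

text \<open>The speeds are the diagonal entries of the diagonalized matrix on the strip, hence
  algebraic expressions in the Lipschitz data. The coefficient matrix also contains
  \<open>bstar\<close> and first derivatives of \<open>q\<close>, so only membership in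
  \<open>BC\<close> is claimed for it.\<close>

lemma assumptions_L_regularity:
  assumes L: "assumptions_L astar bstar q a m"
  shows "(\<lambda>p. matrix_inv (q p) $ i $ k) \<in> BCL" "(\<lambda>p. q p $ i $ k) \<in> BCL" "a j \<in> BCL"
    "(\<lambda>p. b_mat astar bstar q p $ i $ k) \<in> BC"
proof -
  obtain l where l: "l > 0" "\<And>p. p \<in> strip \<Longrightarrow> l \<le> \<bar>det (q p)\<bar>"
    using assumptions_L_bounds[OF L] by metis
  have data: "(\<lambda>p. astar p $ i $ k) \<in> BC1" "(\<lambda>p. bstar p $ i $ k) \<in> BC" "(\<lambda>p. q p $ i $ k) \<in> BC1" for i k
    using L unfolding assumptions_L_def by blast+
  have astar: "(\<lambda>p. astar p $ i $ k) \<in> BCL" and q: "(\<lambda>p. q p $ i $ k) \<in> BCL" for i k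
    using data by (auto intro: BC1_imp_BCL)
  have dq: "dx (\<lambda>p. q p $ i $ k) \<in> BC" "dt (\<lambda>p. q p $ i $ k) \<in> BC" for i k
    using data(3)[of i k] unfolding BC1_def by auto
  have qinv: "(\<lambda>p. matrix_inv (q p) $ i $ k) \<in> BCL" for i k
    by (rule BCL_matrix_inv[OF q l])
  show "(\<lambda>p. matrix_inv (q p) $ i $ k) \<in> BCL" "(\<lambda>p. q p $ i $ k) \<in> BCL"
    by (fact qinv q)+
  have "(\<lambda>p. (matrix_inv (q p) ** astar p ** q p) $ j $ j) \<in> BCL"
    by (simp add: matrix_matrix_mult_def) (intro BCL_sum BCL_mult qinv astar q finite)
  moreover have "a j p = (matrix_inv (q p) ** astar p ** q p) $ j $ j" if "p \<in> strip" for p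
  proof -
    have "matrix_inv (q p) ** astar p ** q p = (\<chi> j k. if j = k then a j p else 0)"
      using L that unfolding assumptions_L_def by blast
    then show ?thesis by simp
  qed
  ultimately show "a j \<in> BCL"
    by (rule BCL_cong)
  show "(\<lambda>p. b_mat astar bstar q p $ i $ k) \<in> BC"
    by (simp add: b_mat_def matrix_matrix_mult_def)
       (intro BC_sum BC_mult BC_add dq data(2) BCL_BC[OF qinv] BCL_BC[OF q] BCL_BC[OF astar] finite)
qed

lemma connected_strip: "connected strip"
  unfolding strip_def by (intro convex_connected convex_Times) auto

text \<open>If both signs occurred, the connected image of the strip would contain 0, against the
  lower bound on the modulus. The encoding \<open>1 - 2 * y\<close> of the sign matches the choice
  of the starting line.\<close>

lemma constant_sign_on_strip:
  fixes f :: "real \<times> real \<Rightarrow> real"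
  assumes "continuous_on strip f" "\<And>p. p \<in> strip \<Longrightarrow> \<gamma> \<le> \<bar>f p\<bar>" "0 < \<gamma>"
  shows "\<exists>y\<in>{0, 1}. \<forall>p\<in>strip. \<gamma> \<le> (1 - 2 * y) * f p"
proof (rule ccontr)
  assume neg: "\<not> ?thesis"
  then obtain p p' where p: "p \<in> strip" "\<not> \<gamma> \<le> f p" "p' \<in> strip" "\<not> \<gamma> \<le> - f p'"
    by auto
  then have "f p \<le> 0" "0 \<le> f p'"
    using assms(2)[of p] assms(2)[of p'] assms(3) by linarith+
  moreover have "connected (f ` strip)"
    by (rule connected_continuous_image[OF assms(1) connected_strip])
  ultimately have "0 \<in> f ` strip"
    using p connectedD_interval[of "f ` strip" "f p" "f p'" 0] by auto
  then show False
    using assms(2,3) by force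
qed

section \<open>From condition (B3) to uniform damping\<close>

lemma condition_B3_imp_damped_transport:
  assumes L: "assumptions_L astar bstar q a m" and B3: "condition_B3 a (b_mat astar bstar q)"
  shows "\<exists>y \<gamma> \<gamma>0 \<kappa>. damped_transport a (b_mat astar bstar q) y \<gamma> \<gamma>0 \<kappa>"
proof -
  obtain l where l: "l > 0" "\<And>p j. p \<in> strip \<Longrightarrow> l \<le> \<bar>a j p\<bar>"
    using assumptions_L_bounds[OF L] by metis
  define b where "b = b_mat astar bstar q"
  define \<gamma> where "\<gamma> = gamma_tilde a b"
  note reg = assumptions_L_regularity[OF L]
  have b_BC: "(\<lambda>p. b p $ i $ k) \<in> BC" for i k
    unfolding b_def by (rule reg)
  have inv_speed: "(\<lambda>p. 1 / a j p) \<in> BCL" for j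
    by (rule BCL_inverse[OF reg(3) l])
  have quot: "(\<lambda>p. b p $ i $ k / a j p) \<in> BC" for i k j
    using BC_mult[OF b_BC BCL_BC[OF inv_speed[of j]], of i k] by simp
  have gamma_le: "\<gamma> j \<le> \<bar>b p $ j $ j / a j p\<bar>" if "p \<in> strip" for j p
    unfolding \<gamma>_def gamma_tilde_def using that by (intro cINF_lower bdd_belowI[of _ 0]) auto
  have gamma_pos: "0 < \<gamma> j" for j
  proof -
    let ?e = "INF p\<in>strip. \<bar>b p $ j $ j\<bar>"
    have "?e \<noteq> 0"
      using B3 unfolding condition_B3_def b_def by blast
    moreover have "0 \<le> ?e"
      by (intro cINF_greatest strip_nonempty) auto
    ultimately have e: "0 < ?e"
      by simp
    obtain M where M: "M > 0" "\<And>p. p \<in> strip \<Longrightarrow> norm (a j p) \<le> M"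
      using BC_bound_pos[OF BCL_BC[OF reg(3)]] by blast
    \<comment> \<open>A nonnegative infimum that is nonzero is positive; the upper bound
      \<open>M\<close> on the speed carries the lower bound on the diagonal coefficient over to the
      quotient.\<close>
    have "?e / M \<le> \<gamma> j"
      unfolding \<gamma>_def gamma_tilde_def
    proof (intro cINF_greatest strip_nonempty)
      fix p assume p: "p \<in> strip"
      have "?e \<le> \<bar>b p $ j $ j\<bar>"
        using p by (intro cINF_lower bdd_belowI[of _ 0]) auto
      then show "?e / M \<le> \<bar>b p $ j $ j / a j p\<bar>"
        unfolding abs_divide using e M(2)[OF p] l(1) l(2)[OF p, of j] by (intro frac_le) auto
    qed
    then show ?thesis
      using e M(1) by (meson divide_pos_pos less_le_trans)
  qed
  have beta: "(\<Sum>k | k \<noteq> j. \<bar>b p $ j $ k / a j p\<bar>) \<le> beta a b j" if "p \<in> strip" for j p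
  proof -
    obtain M where M: "\<And>k p. p \<in> strip \<Longrightarrow> norm (b p $ j $ k / a j p) \<le> M"
      using BC_uniform_bound_pos[of "\<lambda>k p. b p $ j $ k / a j p", OF quot] by metis
    have "bdd_above ((\<lambda>p. \<Sum>k | k \<noteq> j. \<bar>b p $ j $ k / a j p\<bar>) ` strip)"
    proof (rule bdd_aboveI2)
      fix p assume "p \<in> strip"
      then show "(\<Sum>k | k \<noteq> j. \<bar>b p $ j $ k / a j p\<bar>) \<le> (\<Sum>k | k \<noteq> j. M)"
        using M by (intro sum_mono) auto
    qed
    then show ?thesis
      unfolding beta_def using that by (intro cSUP_upper)
  qed
  have beta_nonneg: "0 \<le> beta a b j" for j
  proof -
    have "0 \<le> (\<Sum>k | k \<noteq> j. \<bar>b (0, 0) $ j $ k / a j (0, 0)\<bar>)"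
      by (rule sum_nonneg) simp
    also have "\<dots> \<le> beta a b j"
      by (rule beta) (simp add: mem_strip)
    finally show ?thesis .
  qed
  have ratio: "beta a b j / \<gamma> j < 1" for j
  proof -
    let ?r = "beta a b j / \<gamma> j"
    have r: "0 \<le> ?r"
      using beta_nonneg[of j] gamma_pos[of j] by simp
    have "?r * 1 \<le> ?r * (2 - exp (- \<gamma> j))"
      using r gamma_pos[of j] by (intro mult_left_mono) auto
    also have "\<dots> < 1"
      using B3 unfolding condition_B3_def \<gamma>_def b_def by blast
    finally show ?thesis by simp
  qed
  \<comment> \<open>There are finitely many indices, so one maximum serves all equations and stays
    strictly below 1.\<close>
  define \<kappa> where "\<kappa> = Max (range (\<lambda>j. beta a b j / \<gamma> j))"
  have kappa: "beta a b j / \<gamma> j \<le> \<kappa>" for j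
    unfolding \<kappa>_def by (rule Max_ge) auto
  have "\<forall>j. \<exists>y\<in>{0, 1}. \<forall>p\<in>strip. \<gamma> j \<le> (1 - 2 * y) * (b p $ j $ j / a j p)"
    using quot gamma_le gamma_pos unfolding BC_iff by (intro allI constant_sign_on_strip) auto
  then obtain y where y: "\<And>j. y j \<in> {0, 1}"
    "\<And>j p. p \<in> strip \<Longrightarrow> \<gamma> j \<le> (1 - 2 * y j) * (b p $ j $ j / a j p)"
    by metis
  have "damped_transport a b y \<gamma> (Min (range \<gamma>)) \<kappa>"
  proof
    fix j k and p :: "real \<times> real"
    show "(\<lambda>p. 1 / a j p) \<in> BCL" "(\<lambda>p. b p $ j $ k) \<in> BC" "y j \<in> {0, 1}"
      by (fact inv_speed b_BC y)+
    show "0 < Min (range \<gamma>)"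
      using gamma_pos by (subst Min_gr_iff) auto
    show "Min (range \<gamma>) \<le> \<gamma> j"
      by (rule Min_le) auto
    show "\<gamma> j \<le> (1 - 2 * y j) * (b p $ j $ j / a j p)" if "p \<in> strip"
      using that by (rule y)
    show "0 \<le> \<kappa>"
      using beta_nonneg[of j] gamma_pos[of j] kappa[of j] by (meson divide_nonneg_pos order_trans)
    show "\<kappa> < 1"
      unfolding \<kappa>_def using ratio by (subst Max_less_iff) auto
    show "(\<Sum>k | k \<noteq> j. \<bar>b p $ j $ k / a j p\<bar>) \<le> \<kappa> * \<gamma> j" if "p \<in> strip"
      using beta[OF that, of j] kappa[of j] gamma_pos[of j] by (simp add: pos_divide_le_eq)
  qed
  then show ?thesis
    unfolding b_def by blast
qed

theorem theorem2p2:
  fixes astar bstar q :: "('n::{finite, linorder}) mat_fun"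
    and a :: "'n \<Rightarrow> real \<times> real \<Rightarrow> real"
    and m :: nat
  assumes L: "assumptions_L astar bstar q a m"
    and B3: "condition_B3 a (b_mat astar bstar q)"
  shows "(\<forall>g \<in> BC. \<exists>v. bc_solution astar bstar q a m g v
            \<and> (\<forall>w. bc_solution astar bstar q a m g w \<longrightarrow> (\<forall>p\<in>strip. w p = v p)))
       \<and> (\<exists>K>0. \<forall>g \<in> BC. \<forall>v. bc_solution astar bstar q a m g v
            \<longrightarrow> bc_norm v \<le> K * bc_norm g)"
proof -
  define b where "b = b_mat astar bstar q"
  obtain y \<gamma> \<gamma>0 \<kappa> where "damped_transport a b y \<gamma> \<gamma>0 \<kappa>"
    using condition_B3_imp_damped_transport[OF L B3] unfolding b_def by blast
  then interpret damped_transport a b y \<gamma> \<gamma>0 \<kappa> .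
  obtain l where l: "l > 0" "\<And>p. p \<in> strip \<Longrightarrow> l \<le> \<bar>det (q p)\<bar>" "\<And>p j. p \<in> strip \<Longrightarrow> l \<le> \<bar>a j p\<bar>"
    using assumptions_L_bounds[OF L] by metis
  note reg = assumptions_L_regularity[OF L]
  let ?n = "real CARD('n)" and ?inv = "\<lambda>v p. matrix_inv (q p) *v v p"
  have inv_BC: "?inv v \<in> BC" if "v \<in> BC" for v
    by (rule BC_matrix_vector_mult[where A = "\<lambda>p. matrix_inv (q p)", OF BCL_BC[OF reg(1)] that])
  have q_inv: "q p *v (matrix_inv (q p) *v z) = z" "matrix_inv (q p) *v (q p *v z) = z"
    if "p \<in> strip" for p z
  proof -
    have "invertible (q p)"
      using L that unfolding assumptions_L_def by blast
    then show "q p *v (matrix_inv (q p) *v z) = z" "matrix_inv (q p) *v (q p *v z) = z"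
      by (simp_all add: matrix_vector_mul_assoc matrix_inv_mult)
  qed
  \<comment> \<open>The prescribed starting lines follow the sign of the speed, whereas
    \<open>y\<close> follows the sign of the damping coefficient; the equivalence of starting lines
    reconciles them.\<close>
  have solution_iff: "bc_solution astar bstar q a m g v
      \<longleftrightarrow> v \<in> BC \<and> (\<forall>p\<in>strip. duhamel_map (?inv g) (?inv v) p = ?inv v p)" if "g \<in> BC" for g v
  proof -
    have "bc_solution astar bstar q a m g v \<longleftrightarrow> v \<in> BC \<and>
        (\<forall>j. \<forall>(x, t)\<in>strip. ?inv v (x, t) $ j
          = duhamel j (x_start m j) (\<lambda>p. ?inv v p $ j) (coupled_source (?inv g) (?inv v) j) x t)"
      unfolding bc_solution_def Let_def duhamel_def coupled_source_def b_def[symmetric] by (rule refl)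
    also have "\<dots> \<longleftrightarrow> v \<in> BC \<and> (\<forall>p\<in>strip. duhamel_map (?inv g) (?inv v) p = ?inv v p)"
    proof (rule conj_cong[OF refl])
      have start: "x_start m j \<in> {0, 1}" for j :: 'n
        by (simp add: x_start_def)
      assume "v \<in> BC"
      show "(\<forall>j. \<forall>(x, t)\<in>strip. ?inv v (x, t) $ j
          = duhamel j (x_start m j) (\<lambda>p. ?inv v p $ j) (coupled_source (?inv g) (?inv v) j) x t)
        \<longleftrightarrow> (\<forall>p\<in>strip. duhamel_map (?inv g) (?inv v) p = ?inv v p)"
        by (rule duhamel_system_iff_fixpoint[where u = "?inv v",
              OF inv_BC[OF that] inv_BC[OF \<open>v \<in> BC\<close>] start])
    qed
    finally show ?thesis .
  qed
  obtain Mi where Mi: "Mi > 0" "\<And>p i k. p \<in> strip \<Longrightarrow> \<bar>matrix_inv (q p) $ i $ k\<bar> \<le> Mi"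
    using BC_matrix_bound[where A = "\<lambda>p. matrix_inv (q p)", OF BCL_BC[OF reg(1)]] by metis
  obtain Mq where Mq: "Mq > 0" "\<And>p i k. p \<in> strip \<Longrightarrow> \<bar>q p $ i $ k\<bar> \<le> Mq"
    using BC_matrix_bound[where A = q, OF BCL_BC[OF reg(2)]] by metis
  \<comment> \<open>Multiplying by the inverse matrix costs \<open>?n * Mi\<close> and dividing by
    the speed costs \<open>1 / l\<close>. The factor \<open>1 / \<gamma>0\<close> compensates for
    the \<open>\<gamma> j\<close> split off in the source bound.\<close>
  define C where "C = ?n * Mi / (l * \<gamma>0)"
  have C: "0 < C"
    using Mi(1) l(1) gamma0(1) by (simp add: C_def)
  have norm_nonneg: "0 \<le> bc_norm g" if "g \<in> BC" for g :: "'n vec_fun"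
  proof -
    have "\<bar>g (0, 0) $ undefined\<bar> \<le> bc_norm g"
      by (rule abs_le_bc_norm[OF that]) (simp add: mem_strip)
    then show ?thesis
      using abs_ge_zero order_trans by blast
  qed
  have source: "\<bar>?inv g p $ j / a j p\<bar> \<le> \<gamma> j * (C * bc_norm g)" if g: "g \<in> BC" and p: "p \<in> strip" for g p j
  proof -
    have "\<bar>?inv g p $ j\<bar> \<le> ?n * Mi * bc_norm g"
      by (rule abs_matrix_vector_mult_le[OF Mi(2)[OF p] abs_le_bc_norm[OF g p]])
    then have "\<bar>?inv g p $ j / a j p\<bar> \<le> ?n * Mi * bc_norm g / l"
      unfolding abs_divide using l(1) l(3)[OF p, of j] Mi(1) norm_nonneg[OF g] by (intro frac_le) auto
    also have "\<dots> = \<gamma>0 * (C * bc_norm g)"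
      using l(1) gamma0(1) by (simp add: C_def)
    also have "\<dots> \<le> \<gamma> j * (C * bc_norm g)"
      using C norm_nonneg[OF g] by (intro mult_right_mono gamma0) auto
    finally show ?thesis .
  qed
  have "\<exists>v. bc_solution astar bstar q a m g v
      \<and> (\<forall>w. bc_solution astar bstar q a m g w \<longrightarrow> (\<forall>p\<in>strip. w p = v p))" if g: "g \<in> BC" for g
  proof -
    obtain u where u: "u \<in> BC" "\<And>p. p \<in> strip \<Longrightarrow> duhamel_map (?inv g) u p = u p"
      using duhamel_map_fixpoint_exists[OF inv_BC[OF g] source[OF g]] by metis
    \<comment> \<open>The fixed point lives in the diagonalized unknown; multiplication by
      \<open>q\<close> returns to the original one and recovers \<open>u\<close> on the
      strip.\<close>
    define v where "v p = q p *v u p" for p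
    have v: "v \<in> BC"
      unfolding v_def by (rule BC_matrix_vector_mult[where A = q, OF BCL_BC[OF reg(2)] u(1)])
    have vu: "?inv v p = u p" if "p \<in> strip" for p
      by (simp add: v_def q_inv that)
    have v_fix: "duhamel_map (?inv g) (?inv v) p = ?inv v p" if "p \<in> strip" for p
      using duhamel_map_cong[OF vu that] u(2)[OF that] vu[OF that] by simp
    have "w p = v p" if w: "bc_solution astar bstar q a m g w" and p: "p \<in> strip" for w p
    proof -
      have "w \<in> BC" "\<And>p. p \<in> strip \<Longrightarrow> duhamel_map (?inv g) (?inv w) p = ?inv w p"
        using w unfolding solution_iff[OF g] by auto
      then have "?inv w p = ?inv v p"
        using duhamel_map_fixpoint_unique[OF inv_BC[OF g] inv_BC _ inv_BC[OF v] v_fix p] by blast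
      then show ?thesis
        using q_inv(1)[OF p] by metis
    qed
    then show ?thesis
      using v v_fix solution_iff[OF g] by blast
  qed
  moreover have "\<exists>K>0. \<forall>g \<in> BC. \<forall>v. bc_solution astar bstar q a m g v \<longrightarrow> bc_norm v \<le> K * bc_norm g"
  \<comment> \<open>The constant combines the a priori bound \<open>C / (1 - \<rho>)\<close> for the
    diagonalized unknown with the cost \<open>?n * Mq\<close> of multiplying by
    \<open>q\<close>.\<close>
  proof (intro exI[of _ "?n * Mq * (C / (1 - \<rho>))"] conjI ballI allI impI)
    show "0 < ?n * Mq * (C / (1 - \<rho>))"
      using Mq(1) C rho by simp
    fix g v :: "'n vec_fun"
    assume g: "g \<in> BC" and "bc_solution astar bstar q a m g v"
    then have v: "v \<in> BC" "\<And>p. p \<in> strip \<Longrightarrow> duhamel_map (?inv g) (?inv v) p = ?inv v p"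
      using solution_iff[OF g] by auto
    show "bc_norm v \<le> ?n * Mq * (C / (1 - \<rho>)) * bc_norm g"
    proof (rule bc_norm_le)
      fix p i assume p: "p \<in> strip"
      have CH: "0 \<le> C * bc_norm g"
        using C norm_nonneg[OF g] by simp
      have "\<bar>?inv v p $ k\<bar> \<le> C * bc_norm g / (1 - \<rho>)" for k
        by (rule duhamel_map_fixpoint_bound[where u = "?inv v",
              OF inv_BC[OF g] inv_BC[OF v(1)] source[OF g] CH v(2) p])
      from abs_matrix_vector_mult_le[OF Mq(2)[OF p] this, of i]
      show "\<bar>v p $ i\<bar> \<le> ?n * Mq * (C / (1 - \<rho>)) * bc_norm g"
        by (simp add: q_inv(1)[OF p])
    qed
  qed
  ultimately show ?thesis
    by blast
qed

end
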